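(* Let $F$ be a field, $A$ a finitely generated free abelian group, $F * A$ a twisted group algebra, and $M$ a nonzero finitely generated $F * A$-module. Then $\mathrm{gk}(M)\ge\mathrm{rk}(A)-\dim(F * A)$.
   Context: A twisted group algebra $F * A$ is an $F$-algebra with $F$-basis $\{\bar a: a\in A\}$ and $\bar a_1\bar a_2=\tau(a_1,a_2)\overline{a_1a_2}$, $\tau$ a 2-cocycle with values in $F\setminus\{0\}$. $\mathrm{gk}$ is Gelfand–Kirillov dimension over $F$; $\dim$ denotes the Krull dimension (which equals the global dimension) of $F * A$. *)

theory Defs
  imports "HOL-Analysis.Analysis"
begin

(* The free abelian group A of rank n is realised concretely as Z^n, i.e. as
   the integer sequences supported in {0..<n}, with pointwise addition. *)
definition Zn :: "nat \<Rightarrow> (nat \<Rightarrow> int) set" where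
  "Zn n = {a. \<forall>i\<ge>n. a i = 0}"

definition gadd :: "(nat \<Rightarrow> int) \<Rightarrow> (nat \<Rightarrow> int) \<Rightarrow> (nat \<Rightarrow> int)" where
  "gadd a b = (\<lambda>i. a i + b i)"

definition gdiff :: "(nat \<Rightarrow> int) \<Rightarrow> (nat \<Rightarrow> int) \<Rightarrow> (nat \<Rightarrow> int)" where
  "gdiff a b = (\<lambda>i. a i - b i)"

(* tau is a 2-cocycle on Zn n with values in F \ {0} (exactly the condition
   making the twisted multiplication associative). *)
definition cocycle :: "nat \<Rightarrow> ((nat \<Rightarrow> int) \<Rightarrow> (nat \<Rightarrow> int) \<Rightarrow> 'f::field) \<Rightarrow> bool" where
  "cocycle n \<tau> \<longleftrightarrow>
     (\<forall>a\<in>Zn n. \<forall>b\<in>Zn n. \<tau> a b \<noteq> 0) \<and>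
     (\<forall>a\<in>Zn n. \<forall>b\<in>Zn n. \<forall>c\<in>Zn n.
        \<tau> a b * \<tau> (gadd a b) c = \<tau> b c * \<tau> a (gadd b c))"

(* Elements of the twisted group algebra F * A: finitely supported functions
   A \<Rightarrow> F, the element x standing for sum_a x(a) abar. *)
definition supp :: "((nat \<Rightarrow> int) \<Rightarrow> 'f::zero) \<Rightarrow> (nat \<Rightarrow> int) set" where
  "supp x = {a. x a \<noteq> 0}"

definition TGA :: "nat \<Rightarrow> ((nat \<Rightarrow> int) \<Rightarrow> 'f::field) set" where
  "TGA n = {x. finite (supp x) \<and> supp x \<subseteq> Zn n}"

definition tadd :: "((nat \<Rightarrow> int) \<Rightarrow> 'f::field) \<Rightarrow> ((nat \<Rightarrow> int) \<Rightarrow> 'f) \<Rightarrow> ((nat \<Rightarrow> int) \<Rightarrow> 'f)" where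
  "tadd x y = (\<lambda>a. x a + y a)"

definition tsmult :: "'f::field \<Rightarrow> ((nat \<Rightarrow> int) \<Rightarrow> 'f) \<Rightarrow> ((nat \<Rightarrow> int) \<Rightarrow> 'f)" where
  "tsmult c x = (\<lambda>a. c * x a)"

(* abar1 * abar2 = tau(a1,a2) (a1 a2)bar, extended bilinearly *)
definition tmul :: "((nat \<Rightarrow> int) \<Rightarrow> (nat \<Rightarrow> int) \<Rightarrow> 'f::field) \<Rightarrow>
    ((nat \<Rightarrow> int) \<Rightarrow> 'f) \<Rightarrow> ((nat \<Rightarrow> int) \<Rightarrow> 'f) \<Rightarrow> ((nat \<Rightarrow> int) \<Rightarrow> 'f)" where
  "tmul \<tau> x y = (\<lambda>c. \<Sum>a\<in>supp x. x a * y (gdiff c a) * \<tau> a (gdiff c a))"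

definition tone :: "((nat \<Rightarrow> int) \<Rightarrow> (nat \<Rightarrow> int) \<Rightarrow> 'f::field) \<Rightarrow> ((nat \<Rightarrow> int) \<Rightarrow> 'f)" where
  "tone \<tau> = (\<lambda>a. if a = (\<lambda>_. 0) then inverse (\<tau> (\<lambda>_. 0) (\<lambda>_. 0)) else 0)"

definition is_module :: "nat \<Rightarrow> ((nat \<Rightarrow> int) \<Rightarrow> (nat \<Rightarrow> int) \<Rightarrow> 'f::field) \<Rightarrow>
    (((nat \<Rightarrow> int) \<Rightarrow> 'f) \<Rightarrow> 'm::ab_group_add \<Rightarrow> 'm) \<Rightarrow> bool" where
  "is_module n \<tau> act \<longleftrightarrow>
     (\<forall>x\<in>TGA n. \<forall>y\<in>TGA n. \<forall>m. act (tadd x y) m = act x m + act y m) \<and>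
     (\<forall>x\<in>TGA n. \<forall>m m'. act x (m + m') = act x m + act x m') \<and>
     (\<forall>x\<in>TGA n. \<forall>y\<in>TGA n. \<forall>m. act (tmul \<tau> x y) m = act x (act y m)) \<and>
     (\<forall>m. act (tone \<tau>) m = m)"

definition fin_gen :: "nat \<Rightarrow> (((nat \<Rightarrow> int) \<Rightarrow> 'f::field) \<Rightarrow> 'm::ab_group_add \<Rightarrow> 'm) \<Rightarrow> bool" where
  "fin_gen n act \<longleftrightarrow> (\<exists>G. finite G \<and>
     (\<forall>m. \<exists>r. (\<forall>g\<in>G. r g \<in> TGA n) \<and> m = (\<Sum>g\<in>G. act (r g) g)))"

definition mscale :: "((nat \<Rightarrow> int) \<Rightarrow> (nat \<Rightarrow> int) \<Rightarrow> 'f::field) \<Rightarrow>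
    (((nat \<Rightarrow> int) \<Rightarrow> 'f) \<Rightarrow> 'm::ab_group_add \<Rightarrow> 'm) \<Rightarrow> 'f \<Rightarrow> 'm \<Rightarrow> 'm" where
  "mscale \<tau> act c m = act (tsmult c (tone \<tau>)) m"

(* products of k elements of S (S spans V, these span V^k) *)
fun prods :: "((nat \<Rightarrow> int) \<Rightarrow> (nat \<Rightarrow> int) \<Rightarrow> 'f::field) \<Rightarrow> ((nat \<Rightarrow> int) \<Rightarrow> 'f) set \<Rightarrow> nat
    \<Rightarrow> ((nat \<Rightarrow> int) \<Rightarrow> 'f) set" where
  "prods \<tau> S 0 = {tone \<tau>}"
| "prods \<tau> S (Suc k) = {tmul \<tau> s p | s p. s \<in> S \<and> p \<in> prods \<tau> S k}"

(* dim_F (V^k W), V = span S, W = span T *)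
definition growth :: "((nat \<Rightarrow> int) \<Rightarrow> (nat \<Rightarrow> int) \<Rightarrow> 'f::field) \<Rightarrow>
    (((nat \<Rightarrow> int) \<Rightarrow> 'f) \<Rightarrow> 'm::ab_group_add \<Rightarrow> 'm) \<Rightarrow>
    ((nat \<Rightarrow> int) \<Rightarrow> 'f) set \<Rightarrow> 'm set \<Rightarrow> nat \<Rightarrow> nat" where
  "growth \<tau> act S T k =
     vector_space.dim (mscale \<tau> act) {act p t | p t. p \<in> prods \<tau> S k \<and> t \<in> T}"

(* Gelfand--Kirillov dimension:
   gk(M) = sup_{V,W} limsup_k log dim(V^k W) / log k
   over finite-dimensional subspaces V of F*A and W of M. *)
definition gk :: "nat \<Rightarrow> ((nat \<Rightarrow> int) \<Rightarrow> (nat \<Rightarrow> int) \<Rightarrow> 'f::field) \<Rightarrow>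
    (((nat \<Rightarrow> int) \<Rightarrow> 'f) \<Rightarrow> 'm::ab_group_add \<Rightarrow> 'm) \<Rightarrow> ereal" where
  "gk n \<tau> act = (SUP ST \<in> {(S, T). finite S \<and> S \<subseteq> TGA n \<and> finite T}.
      limsup (\<lambda>k. ereal (if growth \<tau> act (fst ST) (snd ST) k = 0 then 0
                          else ln (real (growth \<tau> act (fst ST) (snd ST) k)) / ln (real k))))"

definition left_ideal :: "nat \<Rightarrow> ((nat \<Rightarrow> int) \<Rightarrow> (nat \<Rightarrow> int) \<Rightarrow> 'f::field) \<Rightarrow>
    ((nat \<Rightarrow> int) \<Rightarrow> 'f) set \<Rightarrow> bool" where
  "left_ideal n \<tau> L \<longleftrightarrow> L \<subseteq> TGA n \<and> (\<lambda>_. 0) \<in> L \<and>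
     (\<forall>x\<in>L. \<forall>y\<in>L. tadd x y \<in> L) \<and> (\<forall>r\<in>TGA n. \<forall>x\<in>L. tmul \<tau> r x \<in> L)"

definition desc_chain :: "nat \<Rightarrow> ((nat \<Rightarrow> int) \<Rightarrow> (nat \<Rightarrow> int) \<Rightarrow> 'f::field) \<Rightarrow>
    ((nat \<Rightarrow> int) \<Rightarrow> 'f) set \<Rightarrow> ((nat \<Rightarrow> int) \<Rightarrow> 'f) set \<Rightarrow> (nat \<Rightarrow> ((nat \<Rightarrow> int) \<Rightarrow> 'f) set) \<Rightarrow> bool" where
  "desc_chain n \<tau> B A c \<longleftrightarrow> (\<forall>i. left_ideal n \<tau> (c i) \<and> B \<subseteq> c i \<and> c i \<subseteq> A \<and> c (Suc i) \<subseteq> c i)"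

(* dev_le n tau k B A: the interval [B, A] of the lattice of left ideals has
   deviation \<le> k.  (deviation \<le> 0 = artinian; deviation \<le> k+1 iff every
   descending chain has almost all factors of deviation \<le> k.) *)
fun dev_le :: "nat \<Rightarrow> ((nat \<Rightarrow> int) \<Rightarrow> (nat \<Rightarrow> int) \<Rightarrow> 'f::field) \<Rightarrow> nat \<Rightarrow>
    ((nat \<Rightarrow> int) \<Rightarrow> 'f) set \<Rightarrow> ((nat \<Rightarrow> int) \<Rightarrow> 'f) set \<Rightarrow> bool" where
  "dev_le n \<tau> 0 B A = (\<forall>c. desc_chain n \<tau> B A c \<longrightarrow> (\<exists>N. \<forall>i\<ge>N. c (Suc i) = c i))"
| "dev_le n \<tau> (Suc k) B A = (\<forall>c. desc_chain n \<tau> B A c \<longrightarrow>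
      (\<exists>N. \<forall>i\<ge>N. dev_le n \<tau> k (c (Suc i)) (c i)))"

(* (left) Krull dimension (Gabriel--Rentschler) of F*A: deviation of its
   lattice of left ideals; \<infinity> if it does not exist as a natural number. *)
definition krull_dim :: "nat \<Rightarrow> ((nat \<Rightarrow> int) \<Rightarrow> (nat \<Rightarrow> int) \<Rightarrow> 'f::field) \<Rightarrow> enat" where
  "krull_dim n \<tau> = (INF k \<in> {k. dev_le n \<tau> k {\<lambda>_. 0} (TGA n)}. enat k)"

end

theory Submission
  imports Defs "HOL-Library.Function_Algebras" "HOL-Computational_Algebra.Formal_Power_Series"
begin

text \<open>
  Write \<open>F[B]\<close> for the twisted group algebra of a subgroup \<open>B\<close>. Choose a direct summand \<open>B\<close>
  of \<open>A\<close> of least rank \<open>k\<close> such that \<open>M\<close> is finitely generated over \<open>F[B]\<close>. If every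
  generator were annihilated by a nonzero element of \<open>F[B]\<close>, then Nagata's change of variables
  would make \<open>M\<close> finitely generated over a summand of smaller rank; so some element of \<open>M\<close> spans
  a free \<open>F[B]\<close>-module, and its growth shows that the Gelfand--Kirillov dimension of \<open>M\<close> is at
  least \<open>k\<close>.

  On the other hand \<open>M \<otimes> F(A/B)\<close>, with the untwisted group algebra \<open>F(A/B)\<close> of rank
  \<open>r = n - k\<close> and diagonal action, is induced from the \<open>F[B]\<close>-module \<open>M\<close>, hence finitely
  generated. Its submodules \<open>M \<otimes> I\<close>, for ideals \<open>I\<close> of \<open>F(A/B)\<close> defined by the vanishing of
  Taylor coefficients at the identity along initial segments of the lexicographic order, form a
  chain of order type dual to \<open>\<omega>\<^sup>r\<close>, which has deviation \<open>r\<close>. The deviation of a finitely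
  generated module is bounded by that of the ring, so the Krull dimension is at least \<open>r\<close>.
\<close>

section \<open>Twisted group algebras and their modules\<close>

lemma gadd_eq_plus: "gadd a b = a + b"
  by (simp add: gadd_def plus_fun_def)

lemma gdiff_eq_minus: "gdiff a b = a - b"
  by (simp add: gdiff_def fun_diff_def)

lemma tadd_eq_plus: "tadd x y = x + y"
  by (simp add: tadd_def plus_fun_def)

lemma sum_fun_apply: "(\<Sum>i\<in>I. f i) x = (\<Sum>i\<in>I. f i x)"
  by (induction I rule: infinite_finite_induct) auto

lemma Zn_zero [simp]: "0 \<in> Zn n"
  by (simp add: Zn_def)

lemma Zn_add [simp]: "a \<in> Zn n \<Longrightarrow> b \<in> Zn n \<Longrightarrow> a + b \<in> Zn n"
  by (simp add: Zn_def)

lemma Zn_diff [simp]: "a \<in> Zn n \<Longrightarrow> b \<in> Zn n \<Longrightarrow> a - b \<in> Zn n"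
  by (simp add: Zn_def)

lemma Zn_uminus [simp]: "a \<in> Zn n \<Longrightarrow> - a \<in> Zn n"
  by (simp add: Zn_def)

section \<open>Monomials, supports and products of finitely supported functions\<close>

definition single :: "(nat \<Rightarrow> int) \<Rightarrow> 'f::field \<Rightarrow> (nat \<Rightarrow> int) \<Rightarrow> 'f" where
  "single a c = (\<lambda>b. if b = a then c else 0)"

lemma supp_single: "supp (single a c) \<subseteq> {a}"
  by (auto simp: supp_def single_def)

lemma supp_zero [simp]: "supp 0 = {}"
  by (simp add: supp_def)

lemma supp_sum: "supp (\<Sum>i\<in>I. x i) \<subseteq> (\<Union>i\<in>I. supp (x i))"
proof
  fix a assume "a \<in> supp (\<Sum>i\<in>I. x i)"
  then have "(\<Sum>i\<in>I. x i a) \<noteq> 0"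
    by (simp add: supp_def sum_fun_apply)
  then obtain i where "i \<in> I" "x i a \<noteq> 0"
    by (rule sum.not_neutral_contains_not_neutral)
  then show "a \<in> (\<Union>i\<in>I. supp (x i))"
    by (auto simp: supp_def)
qed

lemma supp_tsmult: "supp (tsmult c x) \<subseteq> supp x"
  by (auto simp: supp_def tsmult_def)

lemma TGA_single [simp]: "a \<in> Zn n \<Longrightarrow> single a c \<in> TGA n"
  using supp_single[of a c] by (auto simp: TGA_def intro: finite_subset)

lemma TGA_zero [simp]: "0 \<in> TGA n"
  by (simp add: TGA_def)

lemma TGA_add [simp]:
  assumes "x \<in> TGA n" "y \<in> TGA n"
  shows "x + y \<in> TGA n"
proof -
  have "supp (x + y) \<subseteq> supp x \<union> supp y"
    by (auto simp: supp_def)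
  with assms show ?thesis
    by (auto simp: TGA_def intro: finite_subset)
qed

lemma TGA_sum [simp]: "(\<And>i. i \<in> I \<Longrightarrow> x i \<in> TGA n) \<Longrightarrow> (\<Sum>i\<in>I. x i) \<in> TGA n"
  by (induction I rule: infinite_finite_induct) auto

lemma TGA_tsmult [simp]: "x \<in> TGA n \<Longrightarrow> tsmult c x \<in> TGA n"
  using supp_tsmult[of c x] by (auto simp: TGA_def intro: finite_subset)

lemma TGA_diff [simp]:
  assumes "x \<in> TGA n" "y \<in> TGA n"
  shows "x - y \<in> TGA n"
proof -
  have "supp (x - y) \<subseteq> supp x \<union> supp y"
    by (auto simp: supp_def)
  with assms show ?thesis
    by (auto simp: TGA_def intro: finite_subset)
qed

lemma sum_single_eq:
  assumes "finite I" "supp x \<subseteq> I"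
  shows "(\<Sum>a\<in>I. single a (x a)) = x"
proof
  fix b
  have "(\<Sum>a\<in>I. single a (x a)) b = (\<Sum>a\<in>I. if b = a then x a else 0)"
    by (simp add: sum_fun_apply single_def)
  also have "\<dots> = x b"
    using assms by (auto simp: sum.delta' supp_def)
  finally show "(\<Sum>a\<in>I. single a (x a)) b = x b" .
qed

lemma tmul_eq_sum:
  assumes "finite I" "supp x \<subseteq> I"
  shows "tmul \<tau> x y c = (\<Sum>a\<in>I. x a * y (c - a) * \<tau> a (c - a))"
  unfolding tmul_def gdiff_eq_minus
  by (rule sum.mono_neutral_left) (use assms in \<open>auto simp: supp_def\<close>)

lemma tmul_single_left: "tmul \<tau> (single a c) y b = c * y (b - a) * \<tau> a (b - a)"
  by (subst tmul_eq_sum[OF _ supp_single]) (simp_all add: single_def)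

lemma tmul_single_single:
  "tmul \<tau> (single a c) (single b d) = single (a + b) (c * d * \<tau> a b)"
proof
  fix x
  have "x - a = b \<longleftrightarrow> x = a + b"
    by (auto simp: algebra_simps)
  then show "tmul \<tau> (single a c) (single b d) x = single (a + b) (c * d * \<tau> a b) x"
    unfolding tmul_single_left by (auto simp: single_def)
qed

lemma supp_tmul: "supp (tmul \<tau> x y) \<subseteq> (\<lambda>(a, b). a + b) ` (supp x \<times> supp y)"
proof
  fix c assume "c \<in> supp (tmul \<tau> x y)"
  then have "(\<Sum>a\<in>supp x. x a * y (c - a) * \<tau> a (c - a)) \<noteq> 0"
    unfolding supp_def[of "tmul \<tau> x y"] by (simp add: tmul_def gdiff_eq_minus)
  then obtain a where "a \<in> supp x" "x a * y (c - a) * \<tau> a (c - a) \<noteq> 0"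
    by (rule sum.not_neutral_contains_not_neutral)
  then have "(a, c - a) \<in> supp x \<times> supp y" "c = a + (c - a)"
    by (auto simp: supp_def)
  then show "c \<in> (\<lambda>(a, b). a + b) ` (supp x \<times> supp y)"
    by (metis (no_types, lifting) case_prod_conv image_eqI)
qed

lemma TGA_tmul [simp]:
  assumes "x \<in> TGA n" "y \<in> TGA n"
  shows "tmul \<tau> x y \<in> TGA n"
proof -
  have "(\<lambda>(a, b). a + b) ` (supp x \<times> supp y) \<subseteq> Zn n" "finite ((\<lambda>(a, b). a + b) ` (supp x \<times> supp y))"
    using assms by (auto simp: TGA_def intro!: Zn_add)
  with supp_tmul[of \<tau> x y] show ?thesis
    by (auto simp: TGA_def intro: finite_subset)
qed

lemma tone_eq_single: "tone \<tau> = single 0 (inverse (\<tau> 0 0))"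
  by (simp add: tone_def single_def zero_fun_def)

lemma TGA_tone [simp]: "tone \<tau> \<in> TGA n"
  by (simp add: tone_eq_single)

lemma tsmult_single: "tsmult c (single a d) = single a (c * d)"
  by (auto simp: tsmult_def single_def)

section \<open>Identities for modules over a twisted group algebra\<close>

locale twisted_module =
  fixes n :: nat
    and \<tau> :: "(nat \<Rightarrow> int) \<Rightarrow> (nat \<Rightarrow> int) \<Rightarrow> 'f::field"
    and act :: "((nat \<Rightarrow> int) \<Rightarrow> 'f) \<Rightarrow> 'm::ab_group_add \<Rightarrow> 'm"
  assumes cocycle: "cocycle n \<tau>"
    and is_module: "is_module n \<tau> act"
begin

lemma tau_nonzero: "a \<in> Zn n \<Longrightarrow> b \<in> Zn n \<Longrightarrow> \<tau> a b \<noteq> 0"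
  using cocycle by (simp add: cocycle_def)

text \<open>The cocycle identity at \<open>(0, 0, b)\<close> reads
  \<open>\<tau> 0 0 * \<tau> 0 b = \<tau> 0 b * \<tau> 0 b\<close>, and \<open>\<tau> 0 b\<close>
  cancels. This makes \<open>tone\<close> a left identity.\<close>

lemma tau_zero_left:
  assumes "b \<in> Zn n"
  shows "\<tau> 0 b = \<tau> 0 0"
proof -
  have "\<tau> 0 0 * \<tau> (gadd 0 0) b = \<tau> 0 b * \<tau> 0 (gadd 0 b)"
    using cocycle assms Zn_zero unfolding cocycle_def by blast
  with tau_nonzero[of 0 b] assms show ?thesis
    by (simp add: gadd_eq_plus)
qed

lemma tsmult_eq_tmul:
  assumes "x \<in> TGA n"
  shows "tsmult c x = tmul \<tau> (tsmult c (tone \<tau>)) x"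
proof
  fix a
  show "tsmult c x a = tmul \<tau> (tsmult c (tone \<tau>)) x a"
  proof (cases "a \<in> Zn n")
    case True
    then show ?thesis
      using tau_nonzero[of 0 0]
      by (simp add: tone_eq_single tsmult_single tmul_single_left tau_zero_left[of a])
        (simp add: tsmult_def)
  next
    case False
    with assms have "x a = 0" by (auto simp: TGA_def supp_def)
    then show ?thesis
      by (simp add: tone_eq_single tsmult_single tmul_single_left) (simp add: tsmult_def)
  qed
qed

lemma act_add_left: "x \<in> TGA n \<Longrightarrow> y \<in> TGA n \<Longrightarrow> act (x + y) m = act x m + act y m"
  using is_module by (simp add: is_module_def tadd_eq_plus)

lemma act_add_right: "x \<in> TGA n \<Longrightarrow> act x (m + m') = act x m + act x m'"
  using is_module by (simp add: is_module_def)

lemma act_tmul: "x \<in> TGA n \<Longrightarrow> y \<in> TGA n \<Longrightarrow> act (tmul \<tau> x y) m = act x (act y m)"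
  using is_module by (simp add: is_module_def)

lemma act_tone: "act (tone \<tau>) m = m"
  using is_module by (simp add: is_module_def)

lemma act_zero_left [simp]: "act 0 m = 0"
  using act_add_left[of 0 0 m] by simp

lemma act_zero_right [simp]: "x \<in> TGA n \<Longrightarrow> act x 0 = 0"
  using act_add_right[of x 0 0] by simp

lemma act_diff_left: "x \<in> TGA n \<Longrightarrow> y \<in> TGA n \<Longrightarrow> act (x - y) m = act x m - act y m"
  using act_add_left[of "x - y" y m] by (simp add: algebra_simps)

lemma act_sum_left:
  "(\<And>i. i \<in> I \<Longrightarrow> x i \<in> TGA n) \<Longrightarrow> act (\<Sum>i\<in>I. x i) m = (\<Sum>i\<in>I. act (x i) m)"
  by (induction I rule: infinite_finite_induct) (simp_all add: act_add_left)

lemma act_sum_right: "x \<in> TGA n \<Longrightarrow> act x (\<Sum>i\<in>I. f i) = (\<Sum>i\<in>I. act x (f i))"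
  by (induction I rule: infinite_finite_induct) (simp_all add: act_add_right)

lemma act_tsmult: "x \<in> TGA n \<Longrightarrow> act (tsmult c x) m = mscale \<tau> act c (act x m)"
  unfolding mscale_def by (subst tsmult_eq_tmul) (simp_all add: act_tmul)

lemma act_eq_sum_single:
  assumes "x \<in> TGA n"
  shows "act x m = (\<Sum>a\<in>supp x. act (single a (x a)) m)"
proof -
  have "act (\<Sum>a\<in>supp x. single a (x a)) m = (\<Sum>a\<in>supp x. act (single a (x a)) m)"
    by (rule act_sum_left, rule TGA_single) (use assms in \<open>auto simp: TGA_def\<close>)
  moreover have "(\<Sum>a\<in>supp x. single a (x a)) = x"
    by (rule sum_single_eq) (use assms in \<open>auto simp: TGA_def\<close>)
  ultimately show ?thesis by simp
qed

lemma act_single_single: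
  "a \<in> Zn n \<Longrightarrow> b \<in> Zn n \<Longrightarrow>
    act (single a c) (act (single b d) m) = act (single (a + b) (c * d * \<tau> a b)) m"
  using act_tmul[of "single a c" "single b d" m] by (simp add: tmul_single_single)

lemma vector_space_mscale: "vector_space (mscale \<tau> act)"
proof
  fix a b :: 'f and x y :: 'm
  show "mscale \<tau> act a (x + y) = mscale \<tau> act a x + mscale \<tau> act a y"
    by (simp add: mscale_def act_add_right)
  have "tsmult (a + b) (tone \<tau>) = tsmult a (tone \<tau>) + tsmult b (tone \<tau>)"
    by (auto simp: tsmult_def algebra_simps)
  then show "mscale \<tau> act (a + b) x = mscale \<tau> act a x + mscale \<tau> act b x"
    by (simp add: mscale_def act_add_left)
  have "tsmult (a * b) (tone \<tau>) = tsmult a (tsmult b (tone \<tau>))"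
    by (auto simp: tsmult_def algebra_simps)
  then show "mscale \<tau> act a (mscale \<tau> act b x) = mscale \<tau> act (a * b) x"
    using act_tsmult[of "tsmult b (tone \<tau>)" a x] by (simp add: mscale_def)
  have "tsmult 1 (tone \<tau>) = tone \<tau>"
    by (auto simp: tsmult_def)
  then show "mscale \<tau> act 1 x = x"
    by (simp add: mscale_def act_tone)
qed

sublocale vs: vector_space "mscale \<tau> act"
  by (rule vector_space_mscale)

end


section \<open>Torsion-free elements and growth\<close>

text \<open>Encodes direct summands: for \<open>k \<le> n\<close> the set
  \<open>{a. \<psi> a \<in> Zn k}\<close> is a summand of \<open>Zn n\<close> of rank
  \<open>k\<close>. Since \<psi> acts on all integer sequences, it is a bijection of a type and
  \<open>inv \<psi>\<close> is again of this kind.\<close>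

definition coord_aut :: "nat \<Rightarrow> ((nat \<Rightarrow> int) \<Rightarrow> nat \<Rightarrow> int) \<Rightarrow> bool" where
  "coord_aut n \<psi> \<longleftrightarrow> bij \<psi> \<and> (\<forall>a b. \<psi> (a + b) = \<psi> a + \<psi> b) \<and> (\<forall>a. \<psi> a \<in> Zn n \<longleftrightarrow> a \<in> Zn n)"

lemma Zn_mono: "k \<le> n \<Longrightarrow> Zn k \<subseteq> Zn n"
  by (auto simp: Zn_def)

lemma coord_aut_add: "coord_aut n \<psi> \<Longrightarrow> \<psi> (a + b) = \<psi> a + \<psi> b"
  by (simp add: coord_aut_def)

lemma coord_aut_zero:
  assumes "coord_aut n \<psi>"
  shows "\<psi> 0 = 0"
  using coord_aut_add[OF assms, of 0 0] by simp

lemma coord_aut_diff: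
  assumes "coord_aut n \<psi>"
  shows "\<psi> (a - b) = \<psi> a - \<psi> b"
  using coord_aut_add[OF assms, of "a - b" b] by (simp add: algebra_simps)

lemma coord_aut_Zn_iff: "coord_aut n \<psi> \<Longrightarrow> \<psi> a \<in> Zn n \<longleftrightarrow> a \<in> Zn n"
  by (simp add: coord_aut_def)

lemma coord_aut_inv:
  assumes "coord_aut n \<psi>"
  shows "coord_aut n (inv \<psi>)" "\<psi> (inv \<psi> a) = a" "inv \<psi> (\<psi> a) = a"
proof -
  have bij: "bij \<psi>" and lin: "\<And>a b. \<psi> (a + b) = \<psi> a + \<psi> b"
    and Zn: "\<And>a. \<psi> a \<in> Zn n \<longleftrightarrow> a \<in> Zn n"
    using assms by (auto simp: coord_aut_def)
  have surj: "\<psi> (inv \<psi> a) = a" and inj: "inv \<psi> (\<psi> a) = a" for a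
    using bij by (simp_all add: bij_is_surj surj_f_inv_f bij_is_inj)
  show "\<psi> (inv \<psi> a) = a" "inv \<psi> (\<psi> a) = a"
    by (fact surj, fact inj)
  have "inv \<psi> (a + b) = inv \<psi> a + inv \<psi> b" for a b
    using inj[of "inv \<psi> a + inv \<psi> b"] by (simp add: lin surj)
  moreover have "inv \<psi> a \<in> Zn n \<longleftrightarrow> a \<in> Zn n" for a
    using Zn[of "inv \<psi> a"] by (simp add: surj)
  ultimately show "coord_aut n (inv \<psi>)"
    using bij by (simp add: coord_aut_def bij_imp_bij_inv)
qed

section \<open>Cubes of lattice points\<close>

definition int_box :: "nat \<Rightarrow> nat \<Rightarrow> (nat \<Rightarrow> int) set" where
  "int_box k N = {c. (\<forall>i<k. 0 \<le> c i \<and> c i \<le> int N) \<and> (\<forall>i\<ge>k. c i = 0)}"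

lemma int_box_subset_Zn: "int_box k N \<subseteq> Zn k"
  by (auto simp: int_box_def Zn_def)

lemma int_box_eq_image:
  "int_box k N = (\<lambda>f i. if i < k then f i else 0) ` (PiE {..<k} (\<lambda>_. {0..int N}))"
proof (intro equalityI subsetI)
  fix c assume c: "c \<in> int_box k N"
  then have "c = (\<lambda>i. if i < k then restrict c {..<k} i else 0)"
    by (auto simp: int_box_def)
  moreover have "restrict c {..<k} \<in> PiE {..<k} (\<lambda>_. {0..int N})"
    using c by (auto simp: int_box_def)
  ultimately show "c \<in> (\<lambda>f i. if i < k then f i else 0) ` (PiE {..<k} (\<lambda>_. {0..int N}))"
    by (rule image_eqI)
next
  fix c assume "c \<in> (\<lambda>f i. if i < k then f i else 0) ` (PiE {..<k} (\<lambda>_. {0..int N}))"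
  then obtain f where f: "f \<in> PiE {..<k} (\<lambda>_. {0..int N})" "c = (\<lambda>i. if i < k then f i else 0)"
    by auto
  then have "0 \<le> f i \<and> f i \<le> int N" if "i < k" for i
    using PiE_mem[OF f(1), of i] that by simp
  with f show "c \<in> int_box k N"
    by (simp add: int_box_def)
qed

lemma finite_int_box: "finite (int_box k N)"
  by (simp add: int_box_eq_image finite_PiE)

lemma card_int_box: "card (int_box k N) = (N + 1) ^ k"
proof -
  have "inj_on (\<lambda>f i. if i < k then f i else 0) (PiE {..<k} (\<lambda>_. {0..int N}))"
  proof (rule inj_onI)
    fix f g :: "nat \<Rightarrow> int"
    assume fg: "f \<in> PiE {..<k} (\<lambda>_. {0..int N})" "g \<in> PiE {..<k} (\<lambda>_. {0..int N})"
      "(\<lambda>i. if i < k then f i else 0) = (\<lambda>i. if i < k then g i else 0)"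
    then have "f i = g i" if "i < k" for i
      using that by (auto simp: fun_eq_iff split: if_splits)
    with fg(1,2) show "f = g"
      by (auto intro: PiE_ext)
  qed
  then show ?thesis
    by (simp add: int_box_eq_image card_image card_PiE nat_add_distrib)
qed

text \<open>Lowering every positive coordinate by one lands in the smaller cube. Hence sums of
  \<open>N\<close> points of the unit cube fill the cube of side \<open>N\<close>.\<close>

lemma int_box_Suc:
  assumes "c \<in> int_box k (Suc N)"
  obtains d e where "d \<in> int_box k 1" "e \<in> int_box k N" "c = d + e"
proof
  define d where "d = (\<lambda>i. if c i > 0 then 1 else 0 :: int)"
  show "d \<in> int_box k 1"
    using assms by (simp add: int_box_def d_def)
  have "c i - 1 \<le> int N" if "i < k" for i
    using assms that by (auto simp: int_box_def)
  then show "c - d \<in> int_box k N"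
    using assms by (simp add: int_box_def d_def)
  show "c = d + (c - d)"
    by (simp add: algebra_simps)
qed

lemma finite_prods:
  assumes "finite S"
  shows "finite (prods \<tau> S N)"
  by (induction N) (simp_all add: assms finite_image_set2[of "\<lambda>s. s \<in> S"])

context twisted_module
begin

text \<open>Finite \<open>S\<close> and \<open>T\<close> keep the spanning set finite. This matters
  because \<open>dim\<close> is a \<open>card\<close>, which is 0 for an infinite basis.\<close>

lemma card_le_growth:
  assumes "finite S" "finite T" "vs.independent I"
    and "I \<subseteq> {act p t | p t. p \<in> prods \<tau> S N \<and> t \<in> T}"
  shows "card I \<le> growth \<tau> act S T N"
proof -
  let ?V = "{act p t | p t. p \<in> prods \<tau> S N \<and> t \<in> T}"
  obtain b where b: "b \<subseteq> ?V" "?V \<subseteq> vs.span b" "card b = vs.dim ?V"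
    by (rule vs.basis_exists)
  have "finite ?V"
    using finite_image_set2[of "\<lambda>p. p \<in> prods \<tau> S N" "\<lambda>t. t \<in> T" act] assms(1,2)
    by (simp add: finite_prods)
  then have "finite b"
    using b(1) by (rule finite_subset[rotated])
  then have "card I \<le> card b"
    using vs.independent_span_bound[of b I] assms(3,4) b(2) by blast
  then show ?thesis
    by (simp add: b(3) growth_def)
qed

text \<open>Splitting off one unit-cube point at a time writes each monomial of the cube as a
  product; the scalar \<open>s\<close> collects \<open>inverse (\<tau> 0 0)\<close> and cocycle
  values, all nonzero.\<close>

lemma single_in_prods:
  assumes \<beta>: "coord_aut n \<beta>" and k: "k \<le> n" and c: "c \<in> int_box k N"
  shows "\<exists>s. s \<noteq> 0 \<and> single (\<beta> c) s \<in> prods \<tau> ((\<lambda>c. single (\<beta> c) 1) ` int_box k 1) N"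
  using c
proof (induction N arbitrary: c)
  case 0
  then have "c = 0"
    by (auto simp: int_box_def fun_eq_iff) (metis not_le_imp_less order_antisym)
  then show ?case
    using tau_nonzero[of 0 0] coord_aut_zero[OF \<beta>]
    by (intro exI[of _ "inverse (\<tau> 0 0)"]) (simp add: tone_eq_single flip: zero_fun_def)
next
  case (Suc N)
  obtain d e where de: "d \<in> int_box k 1" "e \<in> int_box k N" "c = d + e"
    using Suc.prems by (rule int_box_Suc)
  obtain s where s: "s \<noteq> 0" "single (\<beta> e) s \<in> prods \<tau> ((\<lambda>c. single (\<beta> c) 1) ` int_box k 1) N"
    using Suc.IH[OF de(2)] by blast
  have "\<beta> d \<in> Zn n" "\<beta> e \<in> Zn n"
    using int_box_subset_Zn[of k] Zn_mono[OF k] de by (auto simp: coord_aut_Zn_iff[OF \<beta>])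
  then have "s * \<tau> (\<beta> d) (\<beta> e) \<noteq> 0"
    using s(1) tau_nonzero by simp
  moreover have "single (\<beta> c) (s * \<tau> (\<beta> d) (\<beta> e)) = tmul \<tau> (single (\<beta> d) 1) (single (\<beta> e) s)"
    by (simp add: tmul_single_single de(3) coord_aut_add[OF \<beta>])
  ultimately show ?case
    using de(1) s(2) by (auto intro!: exI[of _ "s * \<tau> (\<beta> d) (\<beta> e)"])
qed

text \<open>The \<open>(N + 1) ^ k\<close> monomials of a cube send \<open>g\<close> to linearly
  independent elements, because a relation would be an annihilator of \<open>g\<close> in
  \<open>F[B]\<close>. The growth is therefore at least \<open>N ^ k\<close>.\<close>

lemma gk_ge_rank_of_torsion_free:
  assumes \<psi>: "coord_aut n \<psi>" and k: "k \<le> n"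
    and free: "\<And>x. x \<in> TGA n \<Longrightarrow> supp x \<subseteq> {a. \<psi> a \<in> Zn k} \<Longrightarrow> act x g = 0 \<Longrightarrow> x = 0"
  shows "ereal (real k) \<le> gk n \<tau> act"
proof -
  define \<beta> where "\<beta> = inv \<psi>"
  have \<beta>: "coord_aut n \<beta>" and \<psi>\<beta>: "\<And>a. \<psi> (\<beta> a) = a"
    unfolding \<beta>_def by (rule coord_aut_inv[OF \<psi>])+
  have \<beta>_inj: "\<beta> a = \<beta> b \<longleftrightarrow> a = b" for a b
    by (metis \<psi>\<beta>)
  define S where "S = (\<lambda>c. single (\<beta> c) (1 :: 'f)) ` int_box k 1"
  have box_Zn: "\<beta> c \<in> Zn n" if "c \<in> int_box k N" for c N
    using int_box_subset_Zn[of k] Zn_mono[OF k] that by (auto simp: coord_aut_Zn_iff[OF \<beta>])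
  have S: "finite S" "S \<subseteq> TGA n"
    using box_Zn by (auto simp: S_def finite_int_box)
  have growth: "(N + 1) ^ k \<le> growth \<tau> act S {g} N" for N
  proof -
    have "\<forall>c\<in>int_box k N. \<exists>s. s \<noteq> 0 \<and> single (\<beta> c) s \<in> prods \<tau> S N"
      using single_in_prods[OF \<beta> k] unfolding S_def by blast
    from bchoice[OF this] obtain s
      where s: "\<And>c. c \<in> int_box k N \<Longrightarrow> s c \<noteq> 0 \<and> single (\<beta> c) (s c) \<in> prods \<tau> S N"
      by blast
    define v where "v c = act (single (\<beta> c) (s c)) g" for c
    have lin_indep: "f c = 0" if sum: "(\<Sum>c\<in>int_box k N. mscale \<tau> act (f c) (v c)) = 0" and c: "c \<in> int_box k N"
      for f c
    proof -
      \<comment> \<open>The relation pulled back to \<open>F[B]\<close>; it annihilates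
        \<open>g\<close>, so all its coefficients vanish.\<close>
      define x where "x = (\<Sum>c\<in>int_box k N. single (\<beta> c) (f c * s c))"
      have "act x g = (\<Sum>c\<in>int_box k N. mscale \<tau> act (f c) (v c))"
        unfolding x_def v_def
      proof (subst act_sum_left)
        fix c assume "c \<in> int_box k N"
        then show "single (\<beta> c) (f c * s c) \<in> TGA n"
          by (intro TGA_single box_Zn)
      next
        have "act (single (\<beta> c) (f c * s c)) g = mscale \<tau> act (f c) (act (single (\<beta> c) (s c)) g)"
          if "c \<in> int_box k N" for c
          using act_tsmult[of "single (\<beta> c) (s c)" "f c" g] box_Zn[OF that]
          by (simp add: tsmult_single)
        then show "(\<Sum>c\<in>int_box k N. act (single (\<beta> c) (f c * s c)) g) =
            (\<Sum>c\<in>int_box k N. mscale \<tau> act (f c) (act (single (\<beta> c) (s c)) g))"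
          by simp
      qed
      moreover have "x \<in> TGA n"
        unfolding x_def by (rule TGA_sum) (auto intro: TGA_single box_Zn)
      moreover have "supp x \<subseteq> {a. \<psi> a \<in> Zn k}"
        using supp_sum[of "\<lambda>c. single (\<beta> c) (f c * s c)" "int_box k N"] supp_single int_box_subset_Zn
        unfolding x_def by (fastforce simp: \<psi>\<beta>)
      ultimately have "x = 0"
        using free[of x] sum by simp
      then have "x (\<beta> c) = 0"
        by simp
      moreover have "x (\<beta> c) = f c * s c"
        unfolding x_def using c
        by (simp add: sum_fun_apply single_def \<beta>_inj sum.delta' finite_int_box)
      ultimately show ?thesis
        using s[OF c] by simp
    qed
    have inj: "inj_on v (int_box k N)"
    proof (rule inj_onI, rule ccontr)
      fix c d assume cd: "c \<in> int_box k N" "d \<in> int_box k N" "v c = v d" "c \<noteq> d"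
      \<comment> \<open>Independence is a property of the image set, so a collision
        \<open>v c = v d\<close> has to be excluded first: it would be the relation
        \<open>v c - v d = 0\<close>.\<close>
      let ?f = "\<lambda>e. if e = c then 1 else if e = d then -1 else 0 :: 'f"
      have "(\<Sum>e\<in>int_box k N. mscale \<tau> act (?f e) (v e)) = (\<Sum>e\<in>{c, d}. mscale \<tau> act (?f e) (v e))"
        by (rule sum.mono_neutral_right) (use cd in \<open>auto simp: finite_int_box\<close>)
      also have "\<dots> = 0"
        using cd(3,4) by simp
      finally show False
        using lin_indep[of ?f c] cd(1) by simp
    qed
    have "vs.independent (v ` int_box k N)"
    proof (rule vs.independent_if_scalars_zero)
      fix f x
      assume "(\<Sum>x\<in>v ` int_box k N. mscale \<tau> act (f x) x) = 0" "x \<in> v ` int_box k N"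
      then show "f x = 0"
        using lin_indep[of "f \<circ> v"] by (auto simp: sum.reindex[OF inj])
    qed (simp add: finite_int_box)
    moreover have "v ` int_box k N \<subseteq> {act p t | p t. p \<in> prods \<tau> S N \<and> t \<in> {g}}"
      using s unfolding v_def by blast
    ultimately have "card (v ` int_box k N) \<le> growth \<tau> act S {g} N"
      by (intro card_le_growth S) auto
    then show ?thesis
      by (simp add: card_image[OF inj] card_int_box)
  qed
  define q where "q N = ereal (if growth \<tau> act S {g} N = 0 then 0
    else ln (real (growth \<tau> act S {g} N)) / ln (real N))" for N
  \<comment> \<open>From \<open>N = 2\<close> on \<open>ln N\<close> is positive, so dividing by it
    keeps the inequality.\<close>
  have "ereal (real k) \<le> q N" if N: "N \<ge> 2" for N
  proof -
    have "real N ^ k \<le> real ((N + 1) ^ k)"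
      by (simp add: power_mono)
    also have "\<dots> \<le> real (growth \<tau> act S {g} N)"
      using growth[of N] by (simp only: of_nat_le_iff)
    finally have *: "real N ^ k \<le> real (growth \<tau> act S {g} N)" .
    have pos: "0 < real N ^ k" "0 < ln (real N)"
      using N by simp_all
    then have gpos: "0 < real (growth \<tau> act S {g} N)"
      using * by linarith
    have "ln (real N ^ k) \<le> ln (real (growth \<tau> act S {g} N))"
      using * pos(1) gpos by (subst ln_le_cancel_iff)
    then have "real k * ln (real N) \<le> ln (real (growth \<tau> act S {g} N))"
      using N by (simp add: ln_realpow)
    then have "real k \<le> ln (real (growth \<tau> act S {g} N)) / ln (real N)"
      using pos by (simp add: pos_le_divide_eq)
    moreover have "growth \<tau> act S {g} N \<noteq> 0"
      using gpos by simp
    ultimately show ?thesis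
      by (simp add: q_def)
  qed
  then have "ereal (real k) \<le> limsup q"
    by (intro le_Limsup) (auto simp: eventually_sequentially)
  also have "\<dots> \<le> gk n \<tau> act"
    unfolding gk_def q_def
    by (rule SUP_upper2[of "(S, {g})"]) (simp add: S, simp only: fst_conv snd_conv order_refl)
  finally show ?thesis .
qed

end


section \<open>Noether normalisation\<close>

text \<open>The exponent of Nagata's substitution. The coefficient of \<open>x l\<close> is 1, so
  replacing that coordinate by the weight is invertible over the integers.\<close>

definition weight :: "int \<Rightarrow> nat \<Rightarrow> (nat \<Rightarrow> int) \<Rightarrow> int" where
  "weight N l x = (\<Sum>i<Suc l. N ^ (l - i) * x i)"

lemma weight_add: "weight N l (x + y) = weight N l x + weight N l y"
  by (simp add: weight_def algebra_simps sum.distrib)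

lemma weight_diff: "weight N l (x - y) = weight N l x - weight N l y"
  by (simp add: weight_def algebra_simps sum_subtractf)

text \<open>For distinct \<open>x\<close> and \<open>y\<close> in \<open>A\<close> the weight of
  \<open>x - y\<close> is a nonzero polynomial in \<open>N\<close>, with the coordinates of
  \<open>x - y\<close> as coefficients. These finitely many polynomials have finitely many roots
  altogether, and any other integer will do.\<close>

lemma ex_inj_on_weight:
  assumes "finite A" "A \<subseteq> Zn (Suc l)"
  shows "\<exists>N. inj_on (weight N l) A"
proof -
  define p where "p x = (\<Sum>i<Suc l. monom (x i) (l - i))" for x :: "nat \<Rightarrow> int"
  have poly_p: "poly (p x) N = weight N l x" for x N
    by (simp add: p_def weight_def poly_sum poly_monom mult.commute)
  have p_nz: "p x \<noteq> 0" if x: "x \<in> Zn (Suc l)" "x \<noteq> 0" for x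
  proof -
    obtain j where j: "x j \<noteq> 0"
      using x(2) by (auto simp: fun_eq_iff)
    with x(1) have "j \<le> l"
      by (force simp: Zn_def not_less_eq_eq)
    then have "l - i = l - j \<longleftrightarrow> i = j" if "i < Suc l" for i
      using that by auto
    then have "coeff (p x) (l - j) = (\<Sum>i<Suc l. if i = j then x i else 0)"
      unfolding p_def coeff_sum by (intro sum.cong) auto
    then have "coeff (p x) (l - j) = x j"
      using \<open>j \<le> l\<close> by (simp add: sum.delta del: sum.lessThan_Suc)
    with j show ?thesis by auto
  qed
  define R where "R = (\<Union>(x, y)\<in>A \<times> A - Id. {N. poly (p (x - y)) N = 0})"
  have "finite R"
    unfolding R_def
  proof (rule finite_UN_I)
    show "finite (A \<times> A - Id)" using assms(1) by simp
    fix z assume z: "z \<in> A \<times> A - Id"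
    obtain x y where xy: "z = (x, y)" by (cases z)
    with z assms(2) have "x \<in> Zn (Suc l)" "y \<in> Zn (Suc l)" "x - y \<noteq> 0"
      by auto
    then have "p (x - y) \<noteq> 0"
      by (intro p_nz Zn_diff)
    then show "finite (case z of (x, y) \<Rightarrow> {N. poly (p (x - y)) N = 0})"
      unfolding xy by (simp add: poly_roots_finite)
  qed
  then obtain N where N: "N \<notin> R"
    using ex_new_if_finite[OF infinite_UNIV_int] by blast
  have "inj_on (weight N l) A"
  proof (rule inj_onI, rule ccontr)
    fix x y assume "x \<in> A" "y \<in> A" "weight N l x = weight N l y" "x \<noteq> y"
    then have "N \<in> R"
      unfolding R_def by (auto simp: poly_p weight_diff intro!: bexI[of _ "(x, y)"])
    with N show False ..
  qed
  then show ?thesis ..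
qed

definition shear :: "int \<Rightarrow> nat \<Rightarrow> (nat \<Rightarrow> int) \<Rightarrow> nat \<Rightarrow> int" where
  "shear N l x = x(l := weight N l x)"

lemma coord_aut_shear:
  assumes "Suc l \<le> n"
  shows "coord_aut n (shear N l)"
  unfolding coord_aut_def
proof (intro conjI allI)
  let ?s = "\<lambda>x :: nat \<Rightarrow> int. \<Sum>i<l. N ^ (l - i) * x i"
  have eq: "shear N l x = x(l := ?s x + x l)" for x
    by (simp add: shear_def weight_def)
  have s_upd: "?s (x(l := v)) = ?s x" for x v
    by (intro sum.cong) auto
  show "bij (shear N l)"
    unfolding eq
    by (rule bij_betw_byWitness[where f' = "\<lambda>x. x(l := x l - ?s x)"]) (simp_all add: s_upd)
  show "shear N l (a + b) = shear N l a + shear N l b" for a b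
    by (auto simp: shear_def weight_add)
  show "shear N l a \<in> Zn n \<longleftrightarrow> a \<in> Zn n" for a
    using assms by (auto simp: shear_def Zn_def)
qed

lemma coord_aut_comp: "coord_aut n \<phi> \<Longrightarrow> coord_aut n \<psi> \<Longrightarrow> coord_aut n (\<lambda>a. \<phi> (\<psi> a))"
  unfolding coord_aut_def using bij_comp[of \<psi> \<phi>] by (simp add: comp_def)

text \<open>The shear straightens the kernel of the weight, so that this kernel is again a summand
  in the encoding by \<open>coord_aut\<close>, of rank one less.\<close>

lemma shear_in_Zn_iff: "shear N l x \<in> Zn l \<longleftrightarrow> x \<in> Zn (Suc l) \<and> weight N l x = 0"
proof
  assume "shear N l x \<in> Zn l"
  then have *: "(x(l := weight N l x)) i = 0" if "i \<ge> l" for i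
    using that by (simp add: Zn_def shear_def)
  have "x i = 0" if "i \<ge> Suc l" for i
    using *[of i] that by simp
  moreover have "weight N l x = 0"
    using *[of l] by simp
  ultimately show "x \<in> Zn (Suc l) \<and> weight N l x = 0"
    by (simp add: Zn_def)
next
  assume "x \<in> Zn (Suc l) \<and> weight N l x = 0"
  then show "shear N l x \<in> Zn l"
    by (auto simp: Zn_def shear_def)
qed

section \<open>Lowering the rank of a subgroup over which the module is finitely generated\<close>

context twisted_module
begin

text \<open>Generation over \<open>F[B]\<close> as an induction principle. Closure under monomials
  suffices since they span \<open>F[B]\<close>; closure under negation comes from the monomials at
  0.\<close>

definition generates :: "((nat \<Rightarrow> int) \<Rightarrow> nat \<Rightarrow> int) \<Rightarrow> nat \<Rightarrow> 'm set \<Rightarrow> bool" where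
  "generates \<psi> k G \<longleftrightarrow> (\<forall>W. 0 \<in> W \<longrightarrow> (\<forall>u\<in>W. \<forall>v\<in>W. u + v \<in> W) \<longrightarrow>
     (\<forall>u\<in>W. \<forall>a\<in>Zn n. \<forall>c. \<psi> a \<in> Zn k \<longrightarrow> act (single a c) u \<in> W) \<longrightarrow> G \<subseteq> W \<longrightarrow> W = UNIV)"

lemma generatesD:
  assumes "generates \<psi> k G" "0 \<in> W" "\<And>u v. u \<in> W \<Longrightarrow> v \<in> W \<Longrightarrow> u + v \<in> W"
    and "\<And>u a c. u \<in> W \<Longrightarrow> a \<in> Zn n \<Longrightarrow> \<psi> a \<in> Zn k \<Longrightarrow> act (single a c) u \<in> W"
    and "G \<subseteq> W"
  shows "W = UNIV"
  by (rule assms(1)[unfolded generates_def, THEN spec, THEN mp, THEN mp, THEN mp, THEN mp])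
    (simp_all add: assms)

definition torsion_free_elt :: "((nat \<Rightarrow> int) \<Rightarrow> nat \<Rightarrow> int) \<Rightarrow> nat \<Rightarrow> 'm \<Rightarrow> bool" where
  "torsion_free_elt \<psi> k g \<longleftrightarrow>
     (\<forall>x\<in>TGA n. supp x \<subseteq> {a. \<psi> a \<in> Zn k} \<longrightarrow> act x g = 0 \<longrightarrow> x = 0)"

lemma sum_in_closed:
  assumes "0 \<in> W" "\<And>u v. u \<in> W \<Longrightarrow> v \<in> W \<Longrightarrow> u + v \<in> W" "\<And>i. i \<in> I \<Longrightarrow> f i \<in> W"
  shows "(\<Sum>i\<in>I. f i) \<in> (W :: 'm set)"
  using assms(3) by (induction I rule: infinite_finite_induct) (auto intro: assms)

lemma uminus_eq_act_single: "- u = act (single 0 (- inverse (\<tau> 0 0))) u"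
proof -
  have "single 0 (- inverse (\<tau> 0 0)) = tsmult (- 1) (tone \<tau>)"
    by (simp add: tone_eq_single tsmult_single)
  then show ?thesis
    using vs.scale_minus_left[of 1 u] vs.scale_one[of u] by (simp add: mscale_def)
qed

lemma act_single_translate:
  assumes "a \<in> Zn n" "b \<in> Zn n"
  shows "act (single a c) m = act (single (a - b) (c / \<tau> (a - b) b)) (act (single b 1) m)"
  using assms tau_nonzero[of "a - b" b] by (simp add: act_single_single)

text \<open>Multiplying the relation \<open>act x g = 0\<close> by a multiple of the monomial at
  \<open>a - b\<close> moves its term at \<open>b\<close> to \<open>a\<close>. That coefficient is
  nonzero, so it can be scaled to \<open>c\<close>, and the remaining terms express the
  element.\<close>

lemma single_mem_of_leading_term:
  assumes W0: "0 \<in> W" and Wadd: "\<And>u v. u \<in> W \<Longrightarrow> v \<in> W \<Longrightarrow> u + v \<in> W"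
    and Wneg: "\<And>u. u \<in> W \<Longrightarrow> - u \<in> W"
    and x: "x \<in> TGA n" "act x g = 0" and b: "b \<in> supp x" and a: "a \<in> Zn n"
    and rest: "\<And>b' c. b' \<in> supp x - {b} \<Longrightarrow> act (single (a - b + b') c) g \<in> W"
  shows "act (single a c) g \<in> W"
proof -
  have fin: "finite (supp x)" and Zn: "supp x \<subseteq> Zn n"
    using x(1) by (auto simp: TGA_def)
  have nz: "x b * \<tau> (a - b) b \<noteq> 0"
    using b Zn a tau_nonzero[of "a - b" b] by (auto simp: supp_def)
  define s where "s = c / (x b * \<tau> (a - b) b)"
  define y where "y b' = act (single (a - b + b') (s * x b' * \<tau> (a - b) b')) g" for b'
  have ab: "a - b \<in> Zn n"
    using a b Zn by auto
  have "0 = act (single (a - b) s) (act x g)"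
    using ab by (simp add: x(2))
  also have "\<dots> = (\<Sum>b'\<in>supp x. y b')"
    unfolding act_eq_sum_single[OF x(1)] act_sum_right[OF TGA_single[OF ab]] y_def
    using Zn ab by (intro sum.cong refl act_single_single) auto
  also have "\<dots> = y b + (\<Sum>b'\<in>supp x - {b}. y b')"
    using fin b by (rule sum.remove)
  finally have "y b = - (\<Sum>b'\<in>supp x - {b}. y b')"
    by (simp add: eq_neg_iff_add_eq_0)
  moreover have "(\<Sum>b'\<in>supp x - {b}. y b') \<in> W"
    using W0 Wadd by (rule sum_in_closed) (auto simp: y_def rest)
  moreover have "y b = act (single a c) g"
    using nz by (simp add: y_def s_def)
  ultimately show ?thesis
    using Wneg by simp
qed

text \<open>A generic functional separates the supports of annihilators of the
  generators, so their extreme terms are units and multiplying by them lowers the degree; hence the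
  kernel of the functional already generates.\<close>

lemma generates_descent:
  assumes \<psi>: "coord_aut n \<psi>" and l: "Suc l \<le> n" and fin: "finite G"
    and gen: "generates \<psi> (Suc l) G" and tors: "\<And>g. g \<in> G \<Longrightarrow> \<not> torsion_free_elt \<psi> (Suc l) g"
  obtains \<psi>' G' where "coord_aut n \<psi>'" "finite G'" "generates \<psi>' l G'"
proof -
  have "\<forall>g\<in>G. \<exists>x. x \<in> TGA n \<and> supp x \<subseteq> {a. \<psi> a \<in> Zn (Suc l)} \<and> act x g = 0 \<and> x \<noteq> 0"
    using tors unfolding torsion_free_elt_def by blast
  from bchoice[OF this] obtain x where x: "\<And>g. g \<in> G \<Longrightarrow> x g \<in> TGA n"
    "\<And>g. g \<in> G \<Longrightarrow> supp (x g) \<subseteq> {a. \<psi> a \<in> Zn (Suc l)}"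
    "\<And>g. g \<in> G \<Longrightarrow> act (x g) g = 0" "\<And>g. g \<in> G \<Longrightarrow> x g \<noteq> 0"
    by blast
  define A where "A = (\<Union>g\<in>G. supp (x g))"
  have finA: "finite A"
    using fin x(1) by (auto simp: A_def TGA_def)
  have A: "\<psi> ` A \<subseteq> Zn (Suc l)"
    using x(2) by (fastforce simp: A_def)
  obtain N where N: "inj_on (weight N l) (\<psi> ` A)"
    using ex_inj_on_weight[OF finite_imageI[OF finA] A] by blast
  define deg where "deg a = weight N l (\<psi> a)" for a
  have deg_add: "deg (a + b) = deg a + deg b" for a b
    by (simp add: deg_def coord_aut_add[OF \<psi>] weight_add)
  have deg_diff: "deg (a - b) = deg a - deg b" for a b
    by (simp add: deg_def coord_aut_diff[OF \<psi>] weight_diff)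
  have "inj_on \<psi> A"
    using \<psi> by (auto simp: coord_aut_def bij_def intro: inj_on_subset)
  then have deg_inj: "inj_on deg A"
    using comp_inj_on[OF _ N] by (simp add: comp_def deg_def[abs_def])
  define \<psi>' where "\<psi>' a = shear N l (\<psi> a)" for a
  have \<psi>': "coord_aut n \<psi>'"
    unfolding \<psi>'_def using coord_aut_shear[OF l] \<psi> by (rule coord_aut_comp)
  have \<psi>'_iff: "\<psi>' a \<in> Zn l \<longleftrightarrow> \<psi> a \<in> Zn (Suc l) \<and> deg a = 0" for a
    by (simp add: \<psi>'_def deg_def shear_in_Zn_iff)
  \<comment> \<open>An element of degree \<open>v\<close> in the current subgroup: the preimage of
    \<open>v\<close> times the \<open>l\<close>-th unit vector, whose weight is
    \<open>v\<close>.\<close>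
  define t where "t v = inv \<psi> (\<lambda>i. if i = l then v else 0)" for v :: int
  have \<psi>_t: "\<psi> (t v) \<in> Zn (Suc l)" for v
    by (simp add: t_def coord_aut_inv[OF \<psi>] Zn_def)
  have deg_t: "deg (t v) = v" for v
    by (simp add: t_def coord_aut_inv[OF \<psi>] deg_def weight_def)
  have Zn_of: "a \<in> Zn n" if "\<psi> a \<in> Zn (Suc l)" for a
    using that Zn_mono[OF l] coord_aut_Zn_iff[OF \<psi>] by blast
  \<comment> \<open>A crude bound for the gap between two degrees that occur in the
    annihilators.\<close>
  define D where "D = (\<Sum>a\<in>A. \<bar>deg a\<bar>) + (\<Sum>a\<in>A. \<bar>deg a\<bar>)"
  have D: "\<bar>deg a - deg b\<bar> \<le> D" if "a \<in> A" "b \<in> A" for a b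
  proof -
    have "\<bar>deg a\<bar> \<le> (\<Sum>a\<in>A. \<bar>deg a\<bar>)" "\<bar>deg b\<bar> \<le> (\<Sum>a\<in>A. \<bar>deg a\<bar>)"
      using member_le_sum[OF that(1), of "\<lambda>a. \<bar>deg a\<bar>"] member_le_sum[OF that(2), of "\<lambda>a. \<bar>deg a\<bar>"]
        finA by auto
    then show ?thesis
      unfolding D_def by linarith
  qed
  \<comment> \<open>Translates in the window of degrees from \<open>-D\<close> to \<open>D\<close>;
    the annihilators reduce every other degree to this window.\<close>
  define G' where "G' = (\<lambda>(v, g). act (single (t v) 1) g) ` ({-D..D} \<times> G)"
  have "finite G'"
    unfolding G'_def using fin by simp
  moreover have "generates \<psi>' l G'"
    unfolding generates_def
  proof (intro allI impI)
    fix W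
    assume W0: "0 \<in> W" and "\<forall>u\<in>W. \<forall>v\<in>W. u + v \<in> W"
      and "\<forall>u\<in>W. \<forall>a\<in>Zn n. \<forall>c. \<psi>' a \<in> Zn l \<longrightarrow> act (single a c) u \<in> W" and G'W: "G' \<subseteq> W"
    then have Wadd: "\<And>u v. u \<in> W \<Longrightarrow> v \<in> W \<Longrightarrow> u + v \<in> W"
      and Wact: "\<And>u a c. u \<in> W \<Longrightarrow> a \<in> Zn n \<Longrightarrow> \<psi>' a \<in> Zn l \<Longrightarrow> act (single a c) u \<in> W"
      by blast+
    have Wneg: "- u \<in> W" if "u \<in> W" for u
      unfolding uminus_eq_act_single[of u] using that
      by (intro Wact) (simp_all add: coord_aut_zero[OF \<psi>'])
    have act_g: "act (single a c) g \<in> W" if g: "g \<in> G" and a: "\<psi> a \<in> Zn (Suc l)" for a c g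
      using a
    proof (induction "nat \<bar>deg a\<bar>" arbitrary: a c rule: less_induct)
      case less
      show ?case
      proof (cases "\<bar>deg a\<bar> \<le> D")
        case True
        \<comment> \<open>In the window, \<open>a\<close> is \<open>t (deg a)\<close> plus an
          element of degree 0: the first gives an element of \<open>G'\<close>, the second acts
          within \<open>W\<close>.\<close>
        have "act (single (t (deg a)) 1) g \<in> W"
          using True g by (intro subsetD[OF G'W]) (auto simp: G'_def intro!: image_eqI[of _ _ "(deg a, g)"])
        moreover have "\<psi>' (a - t (deg a)) \<in> Zn l"
          using less.prems \<psi>_t by (simp add: \<psi>'_iff coord_aut_diff[OF \<psi>] deg_diff deg_t)
        ultimately show ?thesis
          using Zn_of[OF less.prems] Zn_of[OF \<psi>_t]
          by (subst act_single_translate[of a "t (deg a)"]) (auto intro!: Wact)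
      next
        case False
        have supp: "finite (supp (x g))" "supp (x g) \<noteq> {}" "supp (x g) \<subseteq> A"
          using x(1,4)[OF g] g by (auto simp: TGA_def A_def supp_def fun_eq_iff)
        \<comment> \<open>Outside the window, eliminate the extreme term on the side given by the
          sign of \<open>deg a\<close>. As the degree is injective on \<open>A\<close>, all other
          terms move towards 0 by at least 1, and by at most \<open>D\<close>, which is less than
          the absolute degree of \<open>a\<close>; so none crosses 0.\<close>
        obtain b where b: "b \<in> supp (x g)"
          and less_b: "\<And>b'. b' \<in> supp (x g) - {b} \<Longrightarrow> \<bar>deg (a - b + b')\<bar> < \<bar>deg a\<bar>"
        proof (cases "deg a > 0")
          case True
          have "Max (deg ` supp (x g)) \<in> deg ` supp (x g)"
            using supp by (intro Max_in) auto
          then obtain b where b: "b \<in> supp (x g)" "deg b = Max (deg ` supp (x g))"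
            by force
          show thesis
          proof (rule that[OF b(1)])
            fix b' assume b': "b' \<in> supp (x g) - {b}"
            then have "deg b' \<le> deg b"
              using supp(1) b(2) by simp
            moreover have "deg b' \<noteq> deg b"
              using inj_onD[OF deg_inj, of b' b] b' b(1) supp(3) by auto
            moreover have "\<bar>deg b' - deg b\<bar> \<le> D"
              using b' b(1) supp(3) by (intro D) auto
            ultimately show "\<bar>deg (a - b + b')\<bar> < \<bar>deg a\<bar>"
              using True False by (simp add: deg_add deg_diff)
          qed
        next
          case neg: False
          have "Min (deg ` supp (x g)) \<in> deg ` supp (x g)"
            using supp by (intro Min_in) auto
          then obtain b where b: "b \<in> supp (x g)" "deg b = Min (deg ` supp (x g))"
            by force
          show thesis
          proof (rule that[OF b(1)])
            fix b' assume b': "b' \<in> supp (x g) - {b}"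
            then have "deg b \<le> deg b'"
              using supp(1) b(2) by simp
            moreover have "deg b' \<noteq> deg b"
              using inj_onD[OF deg_inj, of b' b] b' b(1) supp(3) by auto
            moreover have "\<bar>deg b' - deg b\<bar> \<le> D"
              using b' b(1) supp(3) by (intro D) auto
            ultimately show "\<bar>deg (a - b + b')\<bar> < \<bar>deg a\<bar>"
              using neg False by (simp add: deg_add deg_diff)
          qed
        qed
        have supp_Zn: "\<psi> b' \<in> Zn (Suc l)" if "b' \<in> supp (x g)" for b'
          using x(2)[OF g] that by auto
        show ?thesis
        proof (rule single_mem_of_leading_term[OF W0 Wadd Wneg x(1)[OF g] x(3)[OF g] b Zn_of[OF less.prems]])
          fix b' c assume b': "b' \<in> supp (x g) - {b}"
          show "act (single (a - b + b') c) g \<in> W"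
          proof (rule less.hyps)
            show "nat \<bar>deg (a - b + b')\<bar> < nat \<bar>deg a\<bar>"
              using less_b[OF b'] by simp
            show "\<psi> (a - b + b') \<in> Zn (Suc l)"
              using less.prems supp_Zn b b'
              by (simp add: coord_aut_add[OF \<psi>] coord_aut_diff[OF \<psi>])
          qed
        qed
      qed
    qed
    \<comment> \<open>\<open>W\<close> itself is closed only under the smaller subgroup. The
      elements whose multiples by all monomials of the larger one lie in \<open>W\<close> are closed
      under the larger one, so the hypothesis applies to them; the multiple by the identity then
      returns to \<open>W\<close>.\<close>
    have "{m. \<forall>a c. \<psi> a \<in> Zn (Suc l) \<longrightarrow> act (single a c) m \<in> W} = UNIV" (is "?W = _")
    proof (rule generatesD[OF gen])
      show "0 \<in> ?W"
        using W0 Zn_of by simp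
      show "u + v \<in> ?W" if "u \<in> ?W" "v \<in> ?W" for u v
        using that Wadd Zn_of by (simp add: act_add_right)
      show "act (single a c) u \<in> ?W" if "u \<in> ?W" "a \<in> Zn n" "\<psi> a \<in> Zn (Suc l)" for u a c
        using that Zn_of by (simp add: act_single_single coord_aut_add[OF \<psi>])
      show "G \<subseteq> ?W"
        using act_g by blast
    qed
    moreover have "\<psi> 0 \<in> Zn (Suc l)"
      by (simp add: coord_aut_zero[OF \<psi>])
    ultimately have "act (tone \<tau>) m \<in> W" for m
      unfolding tone_eq_single by blast
    then show "W = UNIV"
      by (auto simp: act_tone)
  qed
  ultimately show thesis
    using that \<psi>' by blast
qed

text \<open>Induction on the rank: if all generators are torsion, one descent applies. In rank 0 the
  subgroup is trivial and \<open>F[B]\<close> is the field, so torsion generators are 0, against the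
  module being nonzero.\<close>

lemma ex_torsion_free_of_generates:
  assumes "\<exists>m::'m. m \<noteq> 0" "k \<le> n" "coord_aut n \<psi>" "finite G" "generates \<psi> k G"
  shows "\<exists>k \<psi> G g. k \<le> n \<and> coord_aut n \<psi> \<and> finite G \<and> generates \<psi> k G \<and> torsion_free_elt \<psi> k g"
  using assms(2-)
proof (induction k arbitrary: \<psi> G)
  case 0
  show ?case
  proof (rule ccontr)
    assume no: "\<not> ?case"
    have "G \<subseteq> {0}"
    proof
      fix g assume "g \<in> G"
      have "\<not> torsion_free_elt \<psi> 0 g"
        using no "0.prems" by blast
      then obtain x where x: "x \<in> TGA n" "supp x \<subseteq> {a. \<psi> a \<in> Zn 0}" "act x g = 0" "x \<noteq> 0"
        by (auto simp: torsion_free_elt_def)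
      have "\<psi> a \<in> Zn 0 \<longleftrightarrow> a = 0" for a
      proof -
        have "\<psi> a \<in> Zn 0 \<longleftrightarrow> \<psi> a = \<psi> 0"
          by (simp add: coord_aut_zero[OF "0.prems"(2)] Zn_def fun_eq_iff)
        then show ?thesis
          using coord_aut_inv(3)[OF "0.prems"(2)] by metis
      qed
      then have supp: "supp x \<subseteq> {0}"
        using x(2) by auto
      then have "x = single 0 (x 0)"
        by (intro ext) (auto simp: supp_def single_def)
      also have "\<dots> = tsmult (x 0 * \<tau> 0 0) (tone \<tau>)"
        using tau_nonzero[of 0 0] by (simp add: tone_eq_single tsmult_single mult.assoc)
      finally have "act x g = mscale \<tau> act (x 0 * \<tau> 0 0) g"
        unfolding mscale_def by (rule arg_cong)
      then have "mscale \<tau> act (x 0 * \<tau> 0 0) g = 0"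
        by (simp add: x(3))
      moreover have "x 0 \<noteq> 0"
        using supp x(4) by (auto simp: supp_def fun_eq_iff)
      ultimately show "g \<in> {0}"
        using tau_nonzero[of 0 0] by simp
    qed
    then have "{0 :: 'm} = UNIV"
      by (intro generatesD[OF "0.prems"(4)]) auto
    with assms(1) show False by auto
  qed
next
  case (Suc l)
  show ?case
  proof (cases "\<exists>g\<in>G. torsion_free_elt \<psi> (Suc l) g")
    case True
    with Suc.prems show ?thesis by blast
  next
    case False
    then obtain \<psi>' G' where "coord_aut n \<psi>'" "finite G'" "generates \<psi>' l G'"
      using generates_descent[OF Suc.prems(2,1,3,4)] by blast
    with Suc.IH Suc.prems(1) show ?thesis by simp
  qed
qed

lemma ex_torsion_free:
  assumes "fin_gen n act" "\<exists>m::'m. m \<noteq> 0"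
  obtains k \<psi> G g where "k \<le> n" "coord_aut n \<psi>" "finite G" "generates \<psi> k G" "torsion_free_elt \<psi> k g"
proof -
  obtain G where G: "finite G" "\<And>m. \<exists>r. (\<forall>g\<in>G. r g \<in> TGA n) \<and> m = (\<Sum>g\<in>G. act (r g) g)"
    using assms(1) by (auto simp: fin_gen_def)
  \<comment> \<open>The descent starts with \<open>B = A\<close>.\<close>
  have "generates id n G"
    unfolding generates_def
  proof (intro allI impI)
    fix W
    assume W0: "0 \<in> W" and Wadd: "\<forall>u\<in>W. \<forall>v\<in>W. u + v \<in> W"
      and Wact: "\<forall>u\<in>W. \<forall>a\<in>Zn n. \<forall>c. id a \<in> Zn n \<longrightarrow> act (single a c) u \<in> W" and GW: "G \<subseteq> W"
    have "m \<in> W" for m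
    proof -
      obtain r where r: "\<And>g. g \<in> G \<Longrightarrow> r g \<in> TGA n" "m = (\<Sum>g\<in>G. act (r g) g)"
        using G(2) by blast
      have "act (r g) g \<in> W" if "g \<in> G" for g
        unfolding act_eq_sum_single[OF r(1)[OF that]]
      proof (rule sum_in_closed)
        show "act (single a (r g a)) g \<in> W" if "a \<in> supp (r g)" for a
          using Wact GW \<open>g \<in> G\<close> that r(1)[OF \<open>g \<in> G\<close>] unfolding TGA_def id_def by blast
      qed (use W0 Wadd in auto)
      then show ?thesis
        unfolding r(2) by (intro sum_in_closed) (use W0 Wadd in auto)
    qed
    then show "W = UNIV" by auto
  qed
  moreover have "coord_aut n id"
    by (simp add: coord_aut_def)
  ultimately show thesis
    using ex_torsion_free_of_generates[OF assms(2) order_refl _ G(1)] that by blast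
qed

end


section \<open>Binomial coefficients and lexicographic sets\<close>

text \<open>Power series admit negative exponents and avoid division by factorials, so the binomial
  coefficients exist in every characteristic.\<close>

definition one_plus_X_powi :: "int \<Rightarrow> 'f::field fps" where
  "one_plus_X_powi v = (if v \<ge> 0 then (1 + fps_X) ^ nat v else inverse (1 + fps_X) ^ nat (- v))"

lemma one_plus_X_powi_zero [simp]: "one_plus_X_powi 0 = 1"
  by (simp add: one_plus_X_powi_def)

lemma one_plus_X_powi_add_one: "one_plus_X_powi (v + 1) = one_plus_X_powi v * (1 + fps_X :: 'f::field fps)"
proof (cases "v \<ge> 0")
  case True
  then show ?thesis
    by (simp add: one_plus_X_powi_def nat_add_distrib)
next
  case False
  then have "nat (- v) = Suc (nat (- (v + 1)))"
    by simp
  moreover have "inverse (1 + fps_X) * (1 + fps_X :: 'f fps) = 1"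
    by (rule inverse_mult_eq_1) simp
  ultimately have "one_plus_X_powi v * (1 + fps_X :: 'f fps) = inverse (1 + fps_X) ^ nat (- (v + 1))"
    using False by (simp add: one_plus_X_powi_def mult.assoc mult.left_commute mult.commute)
  also have "\<dots> = one_plus_X_powi (v + 1)"
    using False by (cases "v + 1 = 0") (auto simp: one_plus_X_powi_def)
  finally show ?thesis ..
qed

lemma one_plus_X_powi_add: "one_plus_X_powi (v + w) = one_plus_X_powi v * (one_plus_X_powi w :: 'f::field fps)"
proof (induction w rule: int_induct[of _ 0])
  case base
  then show ?case by simp
next
  case (step1 i)
  then show ?case
    using one_plus_X_powi_add_one[of "v + i", where 'f = 'f] one_plus_X_powi_add_one[of i, where 'f = 'f]
    by (simp add: add.assoc mult.assoc)
next
  case (step2 i)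
  have "one_plus_X_powi (v + (i - 1)) * (1 + fps_X) = one_plus_X_powi v * one_plus_X_powi (i - 1) * (1 + fps_X :: 'f fps)"
    using step2 one_plus_X_powi_add_one[of "v + (i - 1)", where 'f = 'f] one_plus_X_powi_add_one[of "i - 1", where 'f = 'f]
    by (simp add: mult.assoc)
  moreover have "(1 + fps_X :: 'f fps) \<noteq> 0"
    by (auto simp: fps_eq_iff intro!: exI[of _ 0])
  ultimately show ?case by simp
qed

text \<open>The binomial coefficient of an arbitrary integer \<open>v\<close> over \<open>j\<close>, reduced to the field.\<close>

definition ibinom :: "int \<Rightarrow> nat \<Rightarrow> 'f::field" where
  "ibinom v j = fps_nth (one_plus_X_powi v) j"

text \<open>Vandermonde's identity, read off from the product of two powers of
  \<open>1 + X\<close>.\<close>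

lemma ibinom_add: "ibinom (v + w) j = (\<Sum>i\<le>j. ibinom v i * ibinom w (j - i))"
  by (simp add: ibinom_def one_plus_X_powi_add fps_mult_nth atLeast0AtMost)

text \<open>Compare the coefficients of \<open>X ^ b\<close> in
  \<open>X ^ a = ((1 + X) - 1) ^ a\<close>. This finite difference isolates a single Taylor
  coefficient.\<close>

lemma sum_ibinom_alternating:
  "(\<Sum>t\<le>a. of_nat (a choose t) * (- 1) ^ (a - t) * ibinom (int t) b) = (if b = a then 1 else 0 :: 'f::field)"
proof -
  have "(fps_X :: 'f fps) ^ a = ((1 + fps_X) + (- 1)) ^ a"
    by simp
  also have "\<dots> = (\<Sum>t\<le>a. of_nat (a choose t) * (1 + fps_X) ^ t * (- 1) ^ (a - t))"
    by (rule binomial_ring)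
  also have "\<dots> = (\<Sum>t\<le>a. fps_const (of_nat (a choose t) * (- 1) ^ (a - t)) * one_plus_X_powi (int t))"
  proof (rule sum.cong[OF refl])
    fix t
    have "(- 1 :: 'f fps) ^ (a - t) = fps_const ((- 1) ^ (a - t))"
      by (simp flip: fps_const_power fps_const_neg)
    then show "of_nat (a choose t) * (1 + fps_X) ^ t * (- 1) ^ (a - t) =
        fps_const (of_nat (a choose t) * (- 1) ^ (a - t)) * (one_plus_X_powi (int t) :: 'f fps)"
      by (simp add: one_plus_X_powi_def mult_ac flip: fps_of_nat fps_const_mult)
  qed
  finally have "fps_nth ((fps_X :: 'f fps) ^ a) b =
      (\<Sum>t\<le>a. of_nat (a choose t) * (- 1) ^ (a - t) * ibinom (int t) b)"
    by (simp add: fps_sum_nth ibinom_def)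
  then show ?thesis
    by (simp add: fps_X_power_nth)
qed

text \<open>The \<beta>-th Taylor coefficient at the identity of the group element \<open>v\<close>:
  the coefficient at \<beta> in the product of the \<open>(1 + X_i) ^ v_i\<close>.\<close>

definition mbinom :: "nat \<Rightarrow> (nat \<Rightarrow> int) \<Rightarrow> (nat \<Rightarrow> nat) \<Rightarrow> 'f::field" where
  "mbinom r v \<beta> = (\<Prod>i<r. ibinom (v i) (\<beta> i))"

lemma mbinom_add:
  "mbinom r (v + w) \<beta> =
    (\<Sum>\<gamma>\<in>PiE {..<r} (\<lambda>i. {..\<beta> i}). mbinom r v \<gamma> * mbinom r w (\<lambda>i. \<beta> i - \<gamma> i))"
  by (simp add: mbinom_def ibinom_add prod_sum_PiE prod.distrib)

lemma sum_mbinom_alternating: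
  "(\<Sum>v\<in>PiE {..<r} (\<lambda>i. {..\<alpha> i}).
      (\<Prod>i<r. of_nat (\<alpha> i choose v i) * (- 1) ^ (\<alpha> i - v i)) * mbinom r (\<lambda>i. int (v i)) \<beta>) =
    (if \<forall>i<r. \<beta> i = \<alpha> i then 1 else 0 :: 'f::field)"
proof -
  have "(\<Sum>v\<in>PiE {..<r} (\<lambda>i. {..\<alpha> i}).
      (\<Prod>i<r. of_nat (\<alpha> i choose v i) * (- 1) ^ (\<alpha> i - v i)) * mbinom r (\<lambda>i. int (v i)) \<beta>) =
    (\<Prod>i<r. \<Sum>t\<le>\<alpha> i. of_nat (\<alpha> i choose t) * (- 1) ^ (\<alpha> i - t) * ibinom (int t) (\<beta> i) :: 'f)"
    by (simp add: mbinom_def prod_sum_PiE prod.distrib)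
  also have "\<dots> = (\<Prod>i<r. if \<beta> i = \<alpha> i then 1 else 0)"
    by (simp add: sum_ibinom_alternating)
  also have "\<dots> = (if \<forall>i<r. \<beta> i = \<alpha> i then 1 else 0)"
    by (auto simp: prod_zero_iff)
  finally show ?thesis .
qed

text \<open>Although the coordinates before \<open>i\<close> are only compared weakly, this is the set of tuples that
  precede \<open>\<alpha>\<close> lexicographically.\<close>

definition lex_below :: "nat \<Rightarrow> (nat \<Rightarrow> nat) \<Rightarrow> (nat \<Rightarrow> nat) set" where
  "lex_below r \<alpha> = {\<beta>. \<exists>i<r. \<beta> i < \<alpha> i \<and> (\<forall>j<i. \<beta> j \<le> \<alpha> j)}"

text \<open>Makes the vanishing conditions stable under the algebra: by the Leibniz rule a moment of
  a product involves only moments at componentwise smaller indices.\<close>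

lemma lex_below_downward:
  assumes "\<beta> \<in> lex_below r \<alpha>" "\<And>i. i < r \<Longrightarrow> \<gamma> i \<le> \<beta> i"
  shows "\<gamma> \<in> lex_below r \<alpha>"
proof -
  obtain i where i: "i < r" "\<beta> i < \<alpha> i" "\<forall>j<i. \<beta> j \<le> \<alpha> j"
    using assms(1) by (auto simp: lex_below_def)
  have "\<gamma> i < \<alpha> i"
    using assms(2)[OF i(1)] i(2) by simp
  moreover have "\<gamma> j \<le> \<alpha> j" if "j < i" for j
    using assms(2)[of j] i that by force
  ultimately show ?thesis
    using i(1) by (auto simp: lex_below_def)
qed

lemma lex_below_mono: "(\<And>i. \<alpha> i \<le> \<alpha>' i) \<Longrightarrow> lex_below r \<alpha> \<subseteq> lex_below r \<alpha>'"
  unfolding lex_below_def by (force intro: order.strict_trans2 order_trans)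

lemma not_lex_below_self: "\<beta> \<in> lex_below r \<alpha> \<Longrightarrow> \<not> (\<forall>i<r. \<beta> i = \<alpha> i)"
  by (auto simp: lex_below_def)

lemma lex_below_upd_Suc: "p < r \<Longrightarrow> \<alpha>(p := i) \<in> lex_below r (\<alpha>(p := Suc i))"
  by (auto simp: lex_below_def intro!: exI[of _ p])

text \<open>Fits infinitely many steps in coordinate \<open>Suc p\<close> between two consecutive
  steps in coordinate \<open>p\<close>, which is how the deviation grows by one.\<close>

lemma lex_below_upd_next:
  assumes "p < r" "\<And>i. i > p \<Longrightarrow> \<alpha> i = 0"
  shows "lex_below r (\<alpha>(p := N, Suc p := i)) \<subseteq> lex_below r (\<alpha>(p := Suc N))"
proof
  fix \<beta> assume "\<beta> \<in> lex_below r (\<alpha>(p := N, Suc p := i))"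
  then obtain q where q: "q < r" "\<beta> q < (\<alpha>(p := N, Suc p := i)) q"
    "\<forall>j<q. \<beta> j \<le> (\<alpha>(p := N, Suc p := i)) j"
    by (auto simp: lex_below_def)
  consider "q \<le> p" | "q = Suc p" | "q > Suc p"
    by linarith
  then show "\<beta> \<in> lex_below r (\<alpha>(p := Suc N))"
  proof cases
    case 1
    then have "\<beta> q < (\<alpha>(p := Suc N)) q"
      using q(2) by (auto split: if_splits)
    moreover have "\<beta> j \<le> (\<alpha>(p := Suc N)) j" if "j < q" for j
      using q(3) 1 that by force
    ultimately show ?thesis
      using q(1) unfolding lex_below_def by blast
  next
    \<comment> \<open>Here \<open>\<beta> p \<le> N < Suc N\<close>, so \<open>p\<close> takes the
      place of \<open>q\<close>. A still later \<open>q\<close> is impossible because \<alpha>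
      vanishes there.\<close>
    case 2
    then have le: "\<beta> j \<le> (\<alpha>(p := N, Suc p := i)) j" if "j \<le> p" for j
      using q(3) that by simp
    have "\<beta> p \<le> N"
      using le[of p] by simp
    moreover have "\<beta> j \<le> \<alpha> j" if "j < p" for j
      using le[of j] that by simp
    ultimately show ?thesis
      using assms(1) by (auto simp: lex_below_def intro!: exI[of _ p])
  next
    case 3
    then show ?thesis
      using q(2) assms(2)[of q] by simp
  qed
qed

section \<open>The Leibniz rule for multiplication by functions on the group\<close>

lemma tmul_zero_right [simp]: "tmul \<tau> x 0 = 0"
  by (auto simp: tmul_def fun_eq_iff)

definition pointwise :: "((nat \<Rightarrow> int) \<Rightarrow> 'f::field) \<Rightarrow> ((nat \<Rightarrow> int) \<Rightarrow> 'f) \<Rightarrow> (nat \<Rightarrow> int) \<Rightarrow> 'f" where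
  "pointwise w x = (\<lambda>a. w a * x a)"

lemma supp_pointwise: "supp (pointwise w x) \<subseteq> supp x"
  by (auto simp: supp_def pointwise_def)

lemma TGA_pointwise [simp]: "x \<in> TGA n \<Longrightarrow> pointwise w x \<in> TGA n"
  using supp_pointwise[of w x] by (auto simp: TGA_def intro: finite_subset)

text \<open>The product at \<open>c\<close> sums over \<open>c = a + (c - a)\<close>; inserting the
  decomposition of \<open>w (a + (c - a))\<close> splits every term.\<close>

lemma pointwise_tmul:
  assumes x: "x \<in> TGA n"
    and w: "\<And>a b. w (a + b) = (\<Sum>\<gamma>\<in>\<Gamma>. u \<gamma> a * v \<gamma> b)"
  shows "pointwise w (tmul \<tau> x y) = (\<Sum>\<gamma>\<in>\<Gamma>. tmul \<tau> (pointwise (u \<gamma>) x) (pointwise (v \<gamma>) y))"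
proof
  fix c
  have fin: "finite (supp x)"
    using x by (simp add: TGA_def)
  have "pointwise w (tmul \<tau> x y) c =
      (\<Sum>a\<in>supp x. w (a + (c - a)) * (x a * y (c - a) * \<tau> a (c - a)))"
    by (simp add: pointwise_def tmul_def gdiff_eq_minus sum_distrib_left)
  also have "\<dots> = (\<Sum>a\<in>supp x. \<Sum>\<gamma>\<in>\<Gamma>. pointwise (u \<gamma>) x a * pointwise (v \<gamma>) y (c - a) * \<tau> a (c - a))"
    unfolding w sum_distrib_right pointwise_def by (intro sum.cong refl) (simp add: mult_ac)
  also have "\<dots> = (\<Sum>\<gamma>\<in>\<Gamma>. \<Sum>a\<in>supp x. pointwise (u \<gamma>) x a * pointwise (v \<gamma>) y (c - a) * \<tau> a (c - a))"
    by (rule sum.swap)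
  also have "\<dots> = (\<Sum>\<gamma>\<in>\<Gamma>. tmul \<tau> (pointwise (u \<gamma>) x) (pointwise (v \<gamma>) y) c)"
    by (simp add: tmul_eq_sum[OF fin supp_pointwise])
  finally show "pointwise w (tmul \<tau> x y) c = (\<Sum>\<gamma>\<in>\<Gamma>. tmul \<tau> (pointwise (u \<gamma>) x) (pointwise (v \<gamma>) y)) c"
    by (simp add: sum_fun_apply)
qed


section \<open>The induced module and Krull dimension\<close>

text \<open>\<open>r\<close> is the rank of \<open>A/B\<close>. The generators are listed by numbers
  below \<open>s\<close> so that elements of the free module are tuples with ordered
  coordinates.\<close>

locale coset_generated_module = twisted_module n \<tau> act
  for n :: nat
    and \<tau> :: "(nat \<Rightarrow> int) \<Rightarrow> (nat \<Rightarrow> int) \<Rightarrow> 'f::field"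
    and act :: "((nat \<Rightarrow> int) \<Rightarrow> 'f) \<Rightarrow> 'm::ab_group_add \<Rightarrow> 'm" +
  fixes \<psi> :: "(nat \<Rightarrow> int) \<Rightarrow> nat \<Rightarrow> int" and k r s :: nat and g :: "nat \<Rightarrow> 'm"
  assumes \<psi>: "coord_aut n \<psi>" and n_eq: "n = k + r"
    and gen: "generates \<psi> k (g ` {..<s})"
begin

definition proj :: "(nat \<Rightarrow> int) \<Rightarrow> nat \<Rightarrow> int" where
  "proj a = (\<lambda>i. \<psi> a (k + i))"

lemma proj_add: "proj (a + b) = proj a + proj b"
  by (auto simp: proj_def coord_aut_add[OF \<psi>])

text \<open>A tuple \<open>x\<close> stands for the element \<open>\<Sum>j<s. x j (g j \<otimes> 1)\<close> of the module
  \<open>M \<otimes> F(A/B)\<close>, where \<open>B\<close> is the kernel of \<^const>\<open>proj\<close>. The \<open>\<beta>\<close>-th moment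
  is the \<open>\<beta>\<close>-th Taylor coefficient at the identity along \<open>A/B\<close>, with values in \<open>M\<close>.\<close>

definition hasse :: "(nat \<Rightarrow> nat) \<Rightarrow> ((nat \<Rightarrow> int) \<Rightarrow> 'f) \<Rightarrow> (nat \<Rightarrow> int) \<Rightarrow> 'f" where
  "hasse \<beta> = pointwise (\<lambda>a. mbinom r (proj a) \<beta>)"

definition moment :: "(nat \<Rightarrow> nat) \<Rightarrow> (nat \<Rightarrow> (nat \<Rightarrow> int) \<Rightarrow> 'f) \<Rightarrow> 'm" where
  "moment \<beta> x = (\<Sum>j<s. act (hasse \<beta> (x j)) (g j))"

lemma TGA_hasse [simp]: "x \<in> TGA n \<Longrightarrow> hasse \<beta> x \<in> TGA n"
  by (simp add: hasse_def)

lemma hasse_add: "hasse \<beta> (x + y) = hasse \<beta> x + hasse \<beta> y"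
  by (auto simp: hasse_def pointwise_def algebra_simps)

lemma hasse_diff: "hasse \<beta> (x - y) = hasse \<beta> x - hasse \<beta> y"
  by (auto simp: hasse_def pointwise_def algebra_simps)

lemma hasse_sum: "hasse \<beta> (\<Sum>i\<in>I. x i) = (\<Sum>i\<in>I. hasse \<beta> (x i))"
  by (auto simp: hasse_def pointwise_def sum_fun_apply sum_distrib_left)

lemma hasse_zero [simp]: "hasse \<beta> 0 = 0"
  by (auto simp: hasse_def pointwise_def)

lemma hasse_tmul:
  assumes "x \<in> TGA n"
  shows "hasse \<beta> (tmul \<tau> x y) =
    (\<Sum>\<gamma>\<in>PiE {..<r} (\<lambda>i. {..\<beta> i}). tmul \<tau> (hasse (\<lambda>i. \<beta> i - \<gamma> i) x) (hasse \<gamma> y))"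
  unfolding hasse_def
proof (rule pointwise_tmul[OF assms])
  show "mbinom r (proj (a + b)) \<beta> = (\<Sum>\<gamma>\<in>PiE {..<r} (\<lambda>i. {..\<beta> i}).
      mbinom r (proj a) (\<lambda>i. \<beta> i - \<gamma> i) * mbinom r (proj b) \<gamma>)" for a b
    using mbinom_add[of r "proj b" "proj a" \<beta>]
    by (simp add: proj_add add.commute mult.commute)
qed

lemma moment_add:
  "(\<And>j. x j \<in> TGA n) \<Longrightarrow> (\<And>j. y j \<in> TGA n) \<Longrightarrow>
    moment \<beta> (\<lambda>j. x j + y j) = moment \<beta> x + moment \<beta> y"
  by (simp add: moment_def hasse_add act_add_left sum.distrib)

lemma moment_diff:
  "(\<And>j. x j \<in> TGA n) \<Longrightarrow> (\<And>j. y j \<in> TGA n) \<Longrightarrow>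
    moment \<beta> (\<lambda>j. x j - y j) = moment \<beta> x - moment \<beta> y"
  by (simp add: moment_def hasse_diff act_diff_left sum_subtractf)

lemma moment_tmul:
  assumes y: "y \<in> TGA n" and x: "\<And>j. x j \<in> TGA n"
  shows "moment \<beta> (\<lambda>j. tmul \<tau> y (x j)) =
    (\<Sum>\<gamma>\<in>PiE {..<r} (\<lambda>i. {..\<beta> i}). act (hasse (\<lambda>i. \<beta> i - \<gamma> i) y) (moment \<gamma> x))"
proof -
  have "moment \<beta> (\<lambda>j. tmul \<tau> y (x j)) = (\<Sum>j<s. \<Sum>\<gamma>\<in>PiE {..<r} (\<lambda>i. {..\<beta> i}).
      act (hasse (\<lambda>i. \<beta> i - \<gamma> i) y) (act (hasse \<gamma> (x j)) (g j)))"
    by (simp add: moment_def hasse_tmul x y act_sum_left act_tmul)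
  also have "\<dots> = (\<Sum>\<gamma>\<in>PiE {..<r} (\<lambda>i. {..\<beta> i}). \<Sum>j<s.
      act (hasse (\<lambda>i. \<beta> i - \<gamma> i) y) (act (hasse \<gamma> (x j)) (g j)))"
    by (rule sum.swap)
  also have "\<dots> = (\<Sum>\<gamma>\<in>PiE {..<r} (\<lambda>i. {..\<beta> i}). act (hasse (\<lambda>i. \<beta> i - \<gamma> i) y) (moment \<gamma> x))"
    by (simp add: moment_def act_sum_right y)
  finally show ?thesis .
qed

section \<open>The lexicographic filtration of the free module and its coordinate ideals\<close>

definition filt :: "(nat \<Rightarrow> nat) \<Rightarrow> (nat \<Rightarrow> (nat \<Rightarrow> int) \<Rightarrow> 'f) set" where
  "filt \<alpha> = {x. (\<forall>j. x j \<in> TGA n) \<and> (\<forall>\<beta>\<in>lex_below r \<alpha>. moment \<beta> x = 0)}"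

text \<open>Leading-coefficient ideals: a submodule of the free module is cut into one left ideal
  per step of the coordinate flag. Chains of submodules thus become chains of left ideals, to which
  \<open>dev_le\<close> applies.\<close>

definition filt_ideal :: "nat \<Rightarrow> (nat \<Rightarrow> nat) \<Rightarrow> ((nat \<Rightarrow> int) \<Rightarrow> 'f) set" where
  "filt_ideal j \<alpha> = {x j | x. x \<in> filt \<alpha> \<and> (\<forall>i>j. x i = 0)}"

lemma filt_antimono: "lex_below r \<alpha> \<subseteq> lex_below r \<alpha>' \<Longrightarrow> filt \<alpha>' \<subseteq> filt \<alpha>"
  by (auto simp: filt_def)

lemma filt_ideal_antimono:
  assumes "lex_below r \<alpha> \<subseteq> lex_below r \<alpha>'"
  shows "filt_ideal j \<alpha>' \<subseteq> filt_ideal j \<alpha>"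
  using filt_antimono[OF assms] unfolding filt_ideal_def by blast

lemma filt_zero: "0 \<in> filt \<alpha>"
  by (simp add: filt_def moment_def)

lemma filt_add: "x \<in> filt \<alpha> \<Longrightarrow> y \<in> filt \<alpha> \<Longrightarrow> (\<lambda>j. x j + y j) \<in> filt \<alpha>"
  by (simp add: filt_def moment_add)

lemma filt_diff: "x \<in> filt \<alpha> \<Longrightarrow> y \<in> filt \<alpha> \<Longrightarrow> (\<lambda>j. x j - y j) \<in> filt \<alpha>"
  by (simp add: filt_def moment_diff)

lemma filt_tmul:
  assumes y: "y \<in> TGA n" and x: "x \<in> filt \<alpha>"
  shows "(\<lambda>j. tmul \<tau> y (x j)) \<in> filt \<alpha>"
proof -
  have TGA: "x j \<in> TGA n" for j
    using x by (simp add: filt_def)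
  have "moment \<beta> (\<lambda>j. tmul \<tau> y (x j)) = 0" if \<beta>: "\<beta> \<in> lex_below r \<alpha>" for \<beta>
    unfolding moment_tmul[OF y TGA]
  proof (rule sum.neutral, rule ballI)
    fix \<gamma> assume \<gamma>: "\<gamma> \<in> PiE {..<r} (\<lambda>i. {..\<beta> i})"
    have "\<gamma> i \<le> \<beta> i" if "i < r" for i
      using PiE_mem[OF \<gamma>, of i] that by simp
    then have "\<gamma> \<in> lex_below r \<alpha>"
      by (rule lex_below_downward[OF \<beta>])
    with x have "moment \<gamma> x = 0"
      by (simp add: filt_def)
    with y show "act (hasse (\<lambda>i. \<beta> i - \<gamma> i) y) (moment \<gamma> x) = 0"
      by simp
  qed
  with TGA y show ?thesis
    by (simp add: filt_def)
qed

lemma left_ideal_filt_ideal: "left_ideal n \<tau> (filt_ideal j \<alpha>)"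
  unfolding left_ideal_def
proof (intro conjI ballI)
  show "filt_ideal j \<alpha> \<subseteq> TGA n"
    by (auto simp: filt_ideal_def filt_def)
  show "(\<lambda>_. 0) \<in> filt_ideal j \<alpha>"
    unfolding filt_ideal_def
    by (rule CollectI, rule exI[of _ 0]) (simp add: filt_zero zero_fun_def[symmetric])
  show "tadd x y \<in> filt_ideal j \<alpha>" if xy: "x \<in> filt_ideal j \<alpha>" "y \<in> filt_ideal j \<alpha>" for x y
  proof -
    obtain x' where x': "x = x' j" "x' \<in> filt \<alpha>" "\<forall>i>j. x' i = 0"
      using xy(1) by (auto simp: filt_ideal_def)
    obtain y' where y': "y = y' j" "y' \<in> filt \<alpha>" "\<forall>i>j. y' i = 0"
      using xy(2) by (auto simp: filt_ideal_def)
    show ?thesis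
      unfolding filt_ideal_def tadd_eq_plus
      using x' y' filt_add[OF x'(2) y'(2)]
      by (intro CollectI exI[of _ "\<lambda>i. x' i + y' i"]) simp
  qed
  show "tmul \<tau> y x \<in> filt_ideal j \<alpha>" if y: "y \<in> TGA n" and x: "x \<in> filt_ideal j \<alpha>" for x y
  proof -
    obtain x' where x': "x = x' j" "x' \<in> filt \<alpha>" "\<forall>i>j. x' i = 0"
      using x by (auto simp: filt_ideal_def)
    show ?thesis
      unfolding filt_ideal_def
      using x' filt_tmul[OF y x'(2)]
      by (intro CollectI exI[of _ "\<lambda>i. tmul \<tau> y (x' i)"]) simp
  qed
qed

text \<open>Peel off the last coordinate: equality of the ideals gives an element of
  \<open>filt \<alpha>'\<close> with the same \<open>J\<close>-th coordinate and zeros after it. The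
  difference stays in \<open>filt \<alpha>\<close> and has one coordinate fewer.\<close>

lemma filt_eq_of_filt_ideal_eq:
  assumes sub: "filt \<alpha>' \<subseteq> filt \<alpha>" and eq: "\<And>j. j < s \<Longrightarrow> filt_ideal j \<alpha> = filt_ideal j \<alpha>'"
    and "J \<le> s" "x \<in> filt \<alpha>" "\<And>i. i \<ge> J \<Longrightarrow> x i = 0"
  shows "x \<in> filt \<alpha>'"
  using assms(3-)
proof (induction J arbitrary: x)
  case 0
  then have "x = 0"
    by (simp add: fun_eq_iff)
  with filt_zero show ?case
    by metis
next
  case (Suc J)
  have "x J \<in> filt_ideal J \<alpha>"
    unfolding filt_ideal_def using Suc.prems by (intro CollectI exI[of _ x]) auto
  then have "x J \<in> filt_ideal J \<alpha>'"
    using eq[of J] Suc.prems(1) by simp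
  then obtain y where y: "x J = y J" "y \<in> filt \<alpha>'" "\<forall>i>J. y i = 0"
    by (auto simp: filt_ideal_def)
  have "(\<lambda>j. x j - y j) \<in> filt \<alpha>'"
  proof (rule Suc.IH)
    show "(\<lambda>j. x j - y j) \<in> filt \<alpha>"
      using Suc.prems(2) y(2) sub by (intro filt_diff) auto
    show "x i - y i = 0" if "i \<ge> J" for i
      using that y Suc.prems(3)[of i] by (cases "i = J") auto
  qed (use Suc.prems in simp)
  from filt_add[OF this y(2)] show ?case by simp
qed

text \<open>Tuples that stand for the pure tensor \<open>m \<otimes> v\<close>: an algebra element
  supported on the coset \<open>v\<close> sends each \<open>g j \<otimes> 1\<close> into
  \<open>M \<otimes> v\<close>.\<close>

definition represents :: "(nat \<Rightarrow> int) \<Rightarrow> (nat \<Rightarrow> (nat \<Rightarrow> int) \<Rightarrow> 'f) \<Rightarrow> 'm \<Rightarrow> bool" where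
  "represents v x m \<longleftrightarrow> (\<forall>j. x j \<in> TGA n) \<and> (\<forall>j\<ge>s. x j = 0) \<and>
     (\<forall>j. \<forall>a\<in>supp (x j). \<forall>i<r. proj a i = v i) \<and> (\<Sum>j<s. act (x j) (g j)) = m"

lemma represents_add:
  assumes "represents v x m" "represents v y m'"
  shows "represents v (\<lambda>j. x j + y j) (m + m')"
proof -
  have "proj a i = v i" if "a \<in> supp (x j + y j)" "i < r" for a i j
  proof -
    have "a \<in> supp (x j) \<or> a \<in> supp (y j)"
      using that(1) by (auto simp: supp_def)
    then show ?thesis
      using assms that(2) by (auto simp: represents_def)
  qed
  then show ?thesis
    using assms by (simp add: represents_def act_add_left sum.distrib)
qed

lemma represents_translate:
  assumes a: "a \<in> Zn n" and x: "represents v x m"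
  shows "represents (proj a + v) (\<lambda>j. tmul \<tau> (single a c) (x j)) (act (single a c) m)"
proof -
  have TGA: "x j \<in> TGA n" for j
    using x by (simp add: represents_def)
  have "proj b i = (proj a + v) i" if b: "b \<in> supp (tmul \<tau> (single a c) (x j))" and i: "i < r" for b i j
  proof -
    obtain b' where "b' \<in> supp (x j)" "b = a + b'"
      using subsetD[OF supp_tmul b] supp_single[of a c] by auto
    then show ?thesis
      using x i by (simp add: proj_add represents_def)
  qed
  moreover have "(\<Sum>j<s. act (tmul \<tau> (single a c) (x j)) (g j)) = act (single a c) m"
    using x a TGA by (simp add: represents_def act_tmul flip: act_sum_right)
  ultimately show ?thesis
    using x a TGA by (simp add: represents_def)
qed

text \<open>Generation over \<open>F[B]\<close> enters here: monomials of \<open>B\<close> preserve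
  the trivial coset, so the representable elements are closed under \<open>F[B]\<close>.\<close>

lemma ex_represents_zero: "\<exists>x. represents 0 x m"
proof -
  have "{m. \<exists>x. represents 0 x m} = UNIV"
  proof (rule generatesD[OF gen])
    show "0 \<in> {m. \<exists>x. represents 0 x m}"
      by (auto simp: represents_def intro!: exI[of _ "\<lambda>_. 0"])
    show "u + v \<in> {m. \<exists>x. represents 0 x m}"
      if "u \<in> {m. \<exists>x. represents 0 x m}" "v \<in> {m. \<exists>x. represents 0 x m}" for u v
      using that represents_add by blast
    show "act (single a c) u \<in> {m. \<exists>x. represents 0 x m}"
      if u: "u \<in> {m. \<exists>x. represents 0 x m}" and a: "a \<in> Zn n" "\<psi> a \<in> Zn k" for u a c
    proof -
      obtain x where "represents 0 x u"
        using u by blast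
      from represents_translate[OF a(1) this]
      have "represents (proj a + 0) (\<lambda>j. tmul \<tau> (single a c) (x j)) (act (single a c) u)" .
      moreover have "proj a = 0"
        using a(2) by (auto simp: proj_def Zn_def)
      ultimately show ?thesis by auto
    qed
    show "g ` {..<s} \<subseteq> {m. \<exists>x. represents 0 x m}"
    proof
      fix m assume "m \<in> g ` {..<s}"
      then obtain j where j: "j < s" "m = g j" by auto
      let ?x = "\<lambda>i. if i = j then tone \<tau> else 0"
      have "proj 0 = 0"
        using proj_add[of 0 0] by simp
      then have "proj a = 0" if "a \<in> supp (tone \<tau>)" for a
        using that supp_single[of 0 "inverse (\<tau> 0 0)"] by (auto simp: tone_eq_single)
      moreover have "(\<Sum>i<s. act (?x i) (g i)) = (\<Sum>i<s. if i = j then g i else 0)"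
        by (intro sum.cong) (auto simp: act_tone)
      ultimately have "represents 0 ?x m"
        using j unfolding represents_def by (auto simp: sum.delta)
      then show "m \<in> {m. \<exists>x. represents 0 x m}" by blast
    qed
  qed
  then show ?thesis by blast
qed

text \<open>Choose \<open>a\<close> in the coset \<open>v\<close>, represent the translate of
  \<open>m\<close> by \<open>- a\<close> on the trivial coset, and translate back; the scalar
  \<open>c\<close> compensates for the twist.\<close>

lemma ex_represents: "\<exists>x. represents v x m"
proof -
  define w where "w i = (if k \<le> i \<and> i < n then v (i - k) else 0)" for i
  define a where "a = inv \<psi> w"
  have \<psi>a: "\<psi> a = w"
    by (simp add: a_def coord_aut_inv[OF \<psi>])
  have a: "a \<in> Zn n"
    using coord_aut_Zn_iff[OF \<psi>, of a] by (simp add: \<psi>a w_def Zn_def)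
  have v: "proj a i = v i" if "i < r" for i
    using that by (simp add: proj_def \<psi>a w_def n_eq)
  define c where "c = inverse (\<tau> 0 0) / \<tau> a (- a)"
  have m: "m = act (single a c) (act (single (- a) 1) m)"
    using act_single_translate[of 0 "- a" "inverse (\<tau> 0 0)" m] a act_tone[of m]
    by (simp add: tone_eq_single c_def)
  obtain x where "represents 0 x (act (single (- a) 1) m)"
    using ex_represents_zero by blast
  from represents_translate[OF a this, of c] m
  have "represents (proj a) (\<lambda>j. tmul \<tau> (single a c) (x j)) m"
    by simp
  then have "represents v (\<lambda>j. tmul \<tau> (single a c) (x j)) m"
    using v by (simp add: represents_def)
  then show ?thesis by blast
qed

lemma hasse_of_represents:
  assumes "represents v x m"
  shows "hasse \<beta> (x j) = tsmult (mbinom r v \<beta>) (x j)"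
proof
  fix a
  show "hasse \<beta> (x j) a = tsmult (mbinom r v \<beta>) (x j) a"
  proof (cases "a \<in> supp (x j)")
    case True
    then have "mbinom r (proj a) \<beta> = (mbinom r v \<beta> :: 'f)"
      unfolding mbinom_def using assms by (intro prod.cong) (auto simp: represents_def)
    then show ?thesis
      by (simp add: hasse_def pointwise_def tsmult_def)
  next
    case False
    then show ?thesis
      by (simp add: hasse_def pointwise_def tsmult_def supp_def)
  qed
qed

text \<open>The tuple stands for \<open>m\<close> tensored with the product of the
  \<open>(Y_i - 1) ^ \<alpha> i\<close>, where the \<open>Y_i\<close> are the coordinate generators
  of \<open>A/B\<close>; only its Taylor coefficient at \<alpha> is nonzero. Expanding the product
  gives the sum over \<open>v\<close> with coefficients \<open>c v\<close>.\<close>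

lemma ex_moment_delta:
  "\<exists>x. (\<forall>j. x j \<in> TGA n) \<and> (\<forall>j\<ge>s. x j = 0) \<and>
     (\<forall>\<beta>. moment \<beta> x = (if \<forall>i<r. \<beta> i = \<alpha> i then m else 0))"
proof -
  have "\<forall>v. \<exists>x. represents (\<lambda>i. int (v i)) x m"
    using ex_represents by blast
  from choice[OF this] obtain X where X: "\<And>v :: nat \<Rightarrow> nat. represents (\<lambda>i. int (v i)) (X v) m"
    by blast
  have TGA: "X v j \<in> TGA n" for v j
    using X[of v] by (simp add: represents_def)
  define I where "I = PiE {..<r} (\<lambda>i. {..\<alpha> i})"
  define c where "c v = (\<Prod>i<r. of_nat (\<alpha> i choose v i) * (- 1) ^ (\<alpha> i - v i) :: 'f)" for v
  define x where "x j = (\<Sum>v\<in>I. tsmult (c v) (X v j))" for j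
  have "moment \<beta> x = (if \<forall>i<r. \<beta> i = \<alpha> i then m else 0)" for \<beta>
  proof -
    let ?b = "\<lambda>v. mbinom r (\<lambda>i. int (v i)) \<beta> :: 'f"
    have "hasse \<beta> (tsmult (c v) (X v j)) = tsmult (c v * ?b v) (X v j)" for v j
    proof -
      have "hasse \<beta> (tsmult (c v) (X v j)) = tsmult (c v) (hasse \<beta> (X v j))"
        by (auto simp: hasse_def pointwise_def tsmult_def)
      then show ?thesis
        unfolding hasse_of_represents[OF X] by (auto simp: tsmult_def)
    qed
    then have "act (hasse \<beta> (x j)) (g j) = (\<Sum>v\<in>I. mscale \<tau> act (c v * ?b v) (act (X v j) (g j)))" for j
      unfolding x_def hasse_sum by (simp add: act_sum_left TGA act_tsmult)
    then have "moment \<beta> x = (\<Sum>j<s. \<Sum>v\<in>I. mscale \<tau> act (c v * ?b v) (act (X v j) (g j)))"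
      by (simp add: moment_def)
    also have "\<dots> = (\<Sum>v\<in>I. \<Sum>j<s. mscale \<tau> act (c v * ?b v) (act (X v j) (g j)))"
      by (rule sum.swap)
    also have "\<dots> = (\<Sum>v\<in>I. mscale \<tau> act (c v * ?b v) m)"
    proof (rule sum.cong[OF refl])
      fix v
      have "(\<Sum>j<s. act (X v j) (g j)) = m"
        using X[of v] by (simp add: represents_def)
      then show "(\<Sum>j<s. mscale \<tau> act (c v * ?b v) (act (X v j) (g j))) = mscale \<tau> act (c v * ?b v) m"
        by (simp flip: vs.scale_sum_right)
    qed
    also have "\<dots> = mscale \<tau> act (\<Sum>v\<in>I. c v * ?b v) m"
      by (rule vs.scale_sum_left[symmetric])
    also have "(\<Sum>v\<in>I. c v * ?b v) = (if \<forall>i<r. \<beta> i = \<alpha> i then 1 else 0)"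
      unfolding I_def c_def by (rule sum_mbinom_alternating)
    finally show ?thesis by auto
  qed
  moreover have "x j = 0" if "j \<ge> s" for j
    using X that unfolding x_def represents_def
    by (intro sum.neutral) (auto simp: tsmult_def)
  ultimately show ?thesis
    using TGA by (intro exI[of _ x]) (simp add: x_def)
qed

section \<open>Strict descent of the filtration and the deviation bound\<close>

lemma filt_ideal_strict:
  assumes "\<exists>m::'m. m \<noteq> 0" "lex_below r \<alpha> \<subseteq> lex_below r \<alpha>'" "\<alpha> \<in> lex_below r \<alpha>'"
  shows "\<exists>j<s. filt_ideal j \<alpha>' \<noteq> filt_ideal j \<alpha>"
proof (rule ccontr)
  assume "\<not> ?thesis"
  then have eq: "filt_ideal j \<alpha> = filt_ideal j \<alpha>'" if "j < s" for j
    using that by auto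
  obtain m :: 'm where m: "m \<noteq> 0"
    using assms(1) by blast
  \<comment> \<open>Its only nonzero moment is at \<alpha>, which is not below itself but is below
    \<alpha>'. So \<open>x\<close> lies in \<open>filt \<alpha>\<close> and not in
    \<open>filt \<alpha>'\<close>.\<close>
  obtain x where x: "\<And>j. x j \<in> TGA n" "\<And>j. j \<ge> s \<Longrightarrow> x j = 0"
    "\<And>\<beta>. moment \<beta> x = (if \<forall>i<r. \<beta> i = \<alpha> i then m else 0)"
    using ex_moment_delta[of \<alpha> m] by blast
  have "x \<in> filt \<alpha>"
    using x(1) not_lex_below_self[of _ r \<alpha>] x(3) unfolding filt_def by auto
  then have "x \<in> filt \<alpha>'"
    using filt_eq_of_filt_ideal_eq[OF filt_antimono[OF assms(2)] eq order_refl] x(2) by blast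
  then have "moment \<alpha> x = 0"
    using assms(3) by (simp add: filt_def)
  with m show False
    by (simp add: x(3))
qed

text \<open>Induction on \<open>d\<close>: raising coordinate \<open>p\<close> gives a descending
  chain, and each of its factors contains the chains for the next coordinate. All \<open>s\<close>
  intervals are treated together because the index \<open>j\<close> of a large factor may change
  from step to step.\<close>

lemma filt_ideal_not_dev_le:
  assumes nz: "\<exists>m::'m. m \<noteq> 0" and "p + d < r" "\<And>i. i \<ge> p \<Longrightarrow> \<alpha> i = 0"
    and "\<And>i j. j < s \<Longrightarrow> Bot j \<subseteq> filt_ideal j (\<alpha>(p := i))"
    and "\<And>i j. j < s \<Longrightarrow> filt_ideal j (\<alpha>(p := i)) \<subseteq> Top j"
  shows "\<exists>j<s. \<not> dev_le n \<tau> d (Bot j) (Top j)"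
  using assms(2-)
proof (induction d arbitrary: p \<alpha> Bot Top)
  case (0 p \<alpha> Bot Top)
  let ?c = "\<lambda>j i. filt_ideal j (\<alpha>(p := i))"
  have mono: "lex_below r (\<alpha>(p := i)) \<subseteq> lex_below r (\<alpha>(p := Suc i))" for i
    by (rule lex_below_mono) simp
  have chain: "desc_chain n \<tau> (Bot j) (Top j) (?c j)" if "j < s" for j
    unfolding desc_chain_def
    using "0.prems"(3,4) that left_ideal_filt_ideal filt_ideal_antimono[OF mono] by blast
  show ?case
  proof (rule ccontr)
    assume "\<not> ?case"
    then have "\<forall>j\<in>{..<s}. \<exists>N. \<forall>i\<ge>N. ?c j (Suc i) = ?c j i"
      using chain by auto
    from bchoice[OF this] obtain N where N: "\<And>j i. j < s \<Longrightarrow> i \<ge> N j \<Longrightarrow> ?c j (Suc i) = ?c j i"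
      by auto
    \<comment> \<open>The sum dominates every \<open>N j\<close>, so one index serves all the
      chains.\<close>
    define K where "K = (\<Sum>j<s. N j)"
    have "?c j (Suc K) = ?c j K" if "j < s" for j
      using that by (intro N) (auto simp: K_def intro!: member_le_sum)
    moreover have "\<exists>j<s. ?c j (Suc K) \<noteq> ?c j K"
      using "0.prems"(1) by (intro filt_ideal_strict[OF nz mono] lex_below_upd_Suc) simp
    ultimately show False by blast
  qed
next
  case (Suc d p \<alpha> Bot Top)
  let ?c = "\<lambda>j i. filt_ideal j (\<alpha>(p := i))"
  have mono: "lex_below r (\<alpha>(p := i)) \<subseteq> lex_below r (\<alpha>(p := Suc i))" for i
    by (rule lex_below_mono) simp
  have chain: "desc_chain n \<tau> (Bot j) (Top j) (?c j)" if "j < s" for j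
    unfolding desc_chain_def
    using Suc.prems(3,4) that left_ideal_filt_ideal filt_ideal_antimono[OF mono] by blast
  show ?case
  proof (rule ccontr)
    assume "\<not> ?case"
    then have "\<forall>j\<in>{..<s}. \<exists>N. \<forall>i\<ge>N. dev_le n \<tau> d (?c j (Suc i)) (?c j i)"
      using chain by auto
    from bchoice[OF this] obtain N
      where N: "\<And>j i. j < s \<Longrightarrow> i \<ge> N j \<Longrightarrow> dev_le n \<tau> d (?c j (Suc i)) (?c j i)"
      by auto
    define K where "K = (\<Sum>j<s. N j)"
    have dev: "dev_le n \<tau> d (?c j (Suc K)) (?c j K)" if "j < s" for j
      using that by (intro N) (auto simp: K_def intro!: member_le_sum)
    have "\<exists>j<s. \<not> dev_le n \<tau> d (?c j (Suc K)) (?c j K)"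
    \<comment> \<open>Inside the factor between steps \<open>K\<close> and \<open>Suc K\<close>,
      coordinate \<open>p\<close> is frozen at \<open>K\<close> and the next one is raised.\<close>
    proof (rule Suc.IH[of "Suc p" "\<alpha>(p := K)"])
      show "Suc p + d < r" using Suc.prems(1) by simp
      show "(\<alpha>(p := K)) i = 0" if "Suc p \<le> i" for i
        using that Suc.prems(2) by simp
      show "?c j (Suc K) \<subseteq> filt_ideal j (\<alpha>(p := K, Suc p := i))" for i j
        using Suc.prems(1,2) by (intro filt_ideal_antimono lex_below_upd_next) auto
      show "filt_ideal j (\<alpha>(p := K, Suc p := i)) \<subseteq> ?c j K" for i j
        using Suc.prems(2) by (intro filt_ideal_antimono lex_below_mono) simp
    qed
    with dev show False by blast
  qed
qed

text \<open>Apply the previous bound to \<alpha> = 0 between the zero ideal and the whole algebra.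
  If no finite deviation bound exists, the infimum is over the empty set and equals
  \<infinity>.\<close>

lemma corank_le_krull_dim:
  assumes nz: "\<exists>m::'m. m \<noteq> 0"
  shows "enat r \<le> krull_dim n \<tau>"
  unfolding krull_dim_def
proof (rule INF_greatest)
  fix d assume "d \<in> {d. dev_le n \<tau> d {\<lambda>_. 0} (TGA n)}"
  then have d: "dev_le n \<tau> d {\<lambda>_. 0} (TGA n)" by simp
  have "\<not> d < r"
  proof
    assume "d < r"
    then have "\<exists>j<s. \<not> dev_le n \<tau> d {\<lambda>_. 0} (TGA n)"
      using left_ideal_filt_ideal
      by (intro filt_ideal_not_dev_le[OF nz, of 0 d "\<lambda>_. 0"]) (auto simp: left_ideal_def)
    with d show False by blast
  qed
  then show "enat r \<le> enat d" by simp
qed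

end

theorem corollary5p5:
  fixes n :: nat
    and \<tau> :: "(nat \<Rightarrow> int) \<Rightarrow> (nat \<Rightarrow> int) \<Rightarrow> 'f::field"
    and act :: "((nat \<Rightarrow> int) \<Rightarrow> 'f) \<Rightarrow> 'm::ab_group_add \<Rightarrow> 'm"
  assumes "cocycle n \<tau>"
    and "is_module n \<tau> act"
    and "fin_gen n act"
    and "\<exists>m::'m. m \<noteq> 0"
  shows "gk n \<tau> act \<ge> ereal (real n) - ereal_of_enat (krull_dim n \<tau>)"
proof -
  interpret twisted_module n \<tau> act
    using assms(1,2) by unfold_locales
  obtain k \<psi> G g where k: "k \<le> n" and \<psi>: "coord_aut n \<psi>" and G: "finite G" "generates \<psi> k G"
    and g: "torsion_free_elt \<psi> k g"
    using ex_torsion_free[OF assms(3,4)] .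
  have gk: "ereal (real k) \<le> gk n \<tau> act"
    using g unfolding torsion_free_elt_def
    by (intro gk_ge_rank_of_torsion_free[OF \<psi> k, of g]) blast
  obtain s and h :: "nat \<Rightarrow> 'm" where "G = h ` {..<s}"
    using finite_imp_nat_seg_image_inj_on[OF G(1)] by (auto simp: lessThan_def)
  then interpret coset_generated_module n \<tau> act \<psi> k "n - k" s h
    using \<psi> k G(2) by unfold_locales simp_all
  have "enat (n - k) \<le> krull_dim n \<tau>"
    by (rule corank_le_krull_dim[OF assms(4)])
  then have "ereal (real (n - k)) \<le> ereal_of_enat (krull_dim n \<tau>)"
    by (metis ereal_of_enat_le_iff ereal_of_enat_simps(1))
  \<comment> \<open>Subtraction reverses the corank bound; for infinite Krull dimension the left
    side is \<open>-\<infinity>\<close>.\<close>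
  then have "ereal (real n) - ereal_of_enat (krull_dim n \<tau>) \<le> ereal (real n) - ereal (real (n - k))"
    by (rule ereal_minus_mono[OF order_refl])
  also have "\<dots> = ereal (real k)"
    using k by (simp add: of_nat_diff)
  finally show ?thesis
    using gk by (rule order_trans)
qed

end
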